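(* Assume that $\det(R+B^H\overline{H}B)\neq 0$, that $\mathbb{T}\neq\emptyset$, and that $\mathcal{R}_{\leq}\cap\mathbb{P}\neq\emptyset$. Let $r>1$ be an integer, and let $\{\widehat{Y}_k\}_{k=0}^\infty$ be the sequence generated by the accelerated fixed-point iteration AFPI($r$) (described in the context) with $\mathbf{A}_0=\widehat{A}$, $\mathbf{G}_0=\widehat{G}$, $\mathbf{H}_0=\widehat{H}$ and $\widehat{Y}_0=X_0\in\mathcal{S}_{\geq}$. Then $\{\widehat{Y}_k\}_{k=0}^\infty$ is a nonincreasing sequence (in the order $\geq$ on Hermitian matrices) that converges at least superlinearly to the maximal solution $X_M$ of the conjugate discrete-time algebraic Riccati equation (CDARE) $X=\mathcal{R}(X)$, with the rate of convergence $$\limsup_{k\to\infty}\sqrt[r^k]{\|\widehat{Y}_k-X_M\|}\leq\rho(\widehat{T}_{X_M})^2,$$ provided that $\rho(\widehat{T}_{X_M})<1$.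
   Context: Notation. $M^H$ is the conjugate transpose and $\overline{M}$ the entrywise complex conjugate of a matrix $M$; $I$ is an identity matrix of suitable size; $M\oplus N$ is the block diagonal matrix with blocks $M,N$; $\mathbb{H}_\ell$ is the set of $\ell\times\ell$ complex Hermitian matrices. For Hermitian matrices, $M>0$ ($M\ge 0$) means positive definite (positive semidefinite), and $M\geq N$ means $M-N\geq 0$. $\rho$ is the spectral radius and $\|\cdot\|$ a matrix norm. Speed of convergence is understood in the root (R-) sense, as quantified by the displayed $\limsup$. Data. $A\in\mathbb{C}^{n\times n}$, $B\in\mathbb{C}^{n\times m}$, $R\in\mathbb{H}_m$ nonsingular, $H\in\mathbb{H}_n$, $G:=BR^{-1}B^H$. For $X\in\mathbb{H}_n$ put $R_X:=R+B^H\overline{X}B$ (so $R_H=R+B^H\overline{H}B$), and $\mathrm{dom}(\mathcal{R}):=\{X\in\mathbb{H}_n : \det R_X\neq 0\}$. For $X\in\mathrm{dom}(\mathcal{R})$ let $$\mathcal{R}(X):=A^H\overline{X}A-A^H\overline{X}B\,R_X^{-1}B^H\overline{X}A+H=A^H\overline{X}(I+G\overline{X})^{-1}A+H,$$ $F_X:=R_X^{-1}B^H\overline{X}A$, $T_X:=A-BF_X$, $\widehat{T}_X:=\overline{T_X}\,T_X$. Sets: $\mathcal{R}_{\leq}:=\{X\in\mathrm{dom}(\mathcal{R}) : X\leq\mathcal{R}(X)\}$, $\mathbb{P}:=\{X\in\mathrm{dom}(\mathcal{R}) : R_X>0\}$, $\mathbb{T}:=\{X\in\mathrm{dom}(\mathcal{R})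 : \rho(\widehat{T}_X)<1\}$, and $$\mathcal{S}_{\geq}:=\bigcup_{W\in\mathbb{T}}\{X\in\mathbb{H}_n : X-T_W^H\overline{X}\,T_W\geq H+F_W^HRF_W\}.$$ The solutions of the CDARE considered are the Hermitian $X$ with $X=\mathcal{R}(X)$ and $R_X>0$. The maximal solution $X_M$ is the (unique) solution with $X_M\geq X$ for every solution $X$; under the assumptions $\mathbb{T}\neq\emptyset$ and $\mathcal{R}_\leq\cap\mathbb{P}\neq\emptyset$ it is known to exist. Transformed coefficients: $\widehat{A}:=\overline{A}A-\overline{A}B R_H^{-1}B^H\overline{H}A$, $\widehat{B}:=[\,\overline{B}\ \ \overline{A}B\,]$, $\widehat{R}:=\overline{R}\oplus R_H$, $\widehat{G}:=\widehat{B}\widehat{R}^{-1}\widehat{B}^H=\overline{G}+\overline{A}(I+G\overline{H})^{-1}G\,\overline{A}^H$, $\widehat{H}:=H+A^H\overline{H}(I+G\overline{H})^{-1}A$. AFPI($r$). Given $\mathbf{A}_0\in\mathbb{C}^{n\times n}$, $\mathbf{G}_0,\mathbf{H}_0,\widehat{Y}_0\in\mathbb{H}_n$ and an integer $r>1$, for $k=0,1,2,\dots$ (ignoring the stopping criterion) set $A_k^{(1)}=\mathbf{A}_k$, $G_k^{(1)}=\mathbf{G}_k$, $H_k^{(1)}=\mathbf{H}_k$; for $l=1,\dots,r-2$ set $$A_k^{(l+1)}=A_k^{(l)}(I+\mathbf{G}_kH_k^{(l)})^{-1}\mathbf{A}_k,$$ $$G_k^{(l+1)}=G_k^{(l)}+A_k^{(l)}(I+\mathbf{G}_kH_k^{(l)})^{-1}\mathbf{G}_k(A_k^{(l)})^H,$$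 $$H_k^{(l+1)}=\mathbf{H}_k+\mathbf{A}_k^HH_k^{(l)}(I+\mathbf{G}_kH_k^{(l)})^{-1}\mathbf{A}_k;$$ then set $$\mathbf{A}_{k+1}=A_k^{(r-1)}(I+\mathbf{G}_kH_k^{(r-1)})^{-1}\mathbf{A}_k,$$ $$\mathbf{G}_{k+1}=G_k^{(r-1)}+A_k^{(r-1)}(I+\mathbf{G}_kH_k^{(r-1)})^{-1}\mathbf{G}_k(A_k^{(r-1)})^H,$$ $$\mathbf{H}_{k+1}=\mathbf{H}_k+\mathbf{A}_k^HH_k^{(r-1)}(I+\mathbf{G}_kH_k^{(r-1)})^{-1}\mathbf{A}_k,$$ $$\widehat{Y}_{k+1}=\mathbf{A}_{k+1}^H\widehat{Y}_0(I+\mathbf{G}_{k+1}\widehat{Y}_0)^{-1}\mathbf{A}_{k+1}+\mathbf{H}_{k+1}.$$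
   Formalization: The formal theorem additionally assumes that AFPI(r) does not break down, i.e. every matrix I+G_k H_k^(l) (k≥0, 1≤l≤r-1) inverted in the coefficient recursion is nonsingular; the stated hypotheses do not guarantee this, and otherwise the sequence is undefined. *)

theory Defs
  imports "HOL-Analysis.Analysis"
begin

section \<open>Complex matrices\<close>

abbreviation mconj :: "complex^'a^'b \<Rightarrow> complex^'a^'b" where
  "mconj \<equiv> map_matrix cnj"

definition adj :: "complex^'a^'b \<Rightarrow> complex^'b^'a" where
  "adj M = transpose (mconj M)"

definition hermitian :: "complex^'a^'a \<Rightarrow> bool" where
  "hermitian M \<longleftrightarrow> adj M = M"

definition quad_form :: "complex^'a^'a \<Rightarrow> complex^'a \<Rightarrow> complex" where
  "quad_form M v = (\<Sum>i\<in>UNIV. cnj (v $ i) * (M *v v) $ i)"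

text \<open>For Hermitian \<open>M\<close> the quadratic form is real-valued, so taking its real part loses nothing.\<close>

definition psd :: "complex^'a^'a \<Rightarrow> bool" where
  "psd M \<longleftrightarrow> hermitian M \<and> (\<forall>v. 0 \<le> Re (quad_form M v))"

definition posdef :: "complex^'a^'a \<Rightarrow> bool" where
  "posdef M \<longleftrightarrow> hermitian M \<and> (\<forall>v. v \<noteq> 0 \<longrightarrow> 0 < Re (quad_form M v))"

definition loewner_ge :: "complex^'a^'a \<Rightarrow> complex^'a^'a \<Rightarrow> bool" (infix "\<succeq>" 50) where
  "M \<succeq> N \<longleftrightarrow> psd (M - N)"

definition spectral_radius :: "complex^'a^'a \<Rightarrow> real" where
  "spectral_radius M = Max {cmod c | c. \<exists>v. v \<noteq> 0 \<and> M *v v = c *s v}"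

text \<open>An arbitrary norm on the space of square matrices; submultiplicativity is not required.\<close>

definition is_matrix_norm :: "(complex^'a^'a \<Rightarrow> real) \<Rightarrow> bool" where
  "is_matrix_norm N \<longleftrightarrow>
     (\<forall>M. 0 \<le> N M) \<and> (\<forall>M. N M = 0 \<longleftrightarrow> M = 0) \<and>
     (\<forall>c M. N (map_matrix ((*) c) M) = cmod c * N M) \<and>
     (\<forall>M M'. N (M + M') \<le> N M + N M')"

text \<open>R-superlinear convergence in the sense of Ortega and Rheinboldt:
  the root-convergence factor \<open>R\<^sub>1\<close> vanishes.\<close>

definition R_superlinear :: "(complex^'a^'a \<Rightarrow> real) \<Rightarrow> (nat \<Rightarrow> complex^'a^'a) \<Rightarrow> complex^'a^'a \<Rightarrow> bool" where
  "R_superlinear N Y L \<longleftrightarrow>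
     Y \<longlonglongrightarrow> L \<and> limsup (\<lambda>k. ereal (root k (N (Y k - L)))) = 0"

section \<open>The conjugate discrete-time algebraic Riccati equation\<close>

definition G_of :: "complex^'m^'n \<Rightarrow> complex^'m^'m \<Rightarrow> complex^'n^'n" where
  "G_of B R = B ** matrix_inv R ** adj B"

definition R_at :: "complex^'m^'n \<Rightarrow> complex^'m^'m \<Rightarrow> complex^'n^'n \<Rightarrow> complex^'m^'m" where
  "R_at B R X = R + adj B ** mconj X ** B"

definition ric_dom :: "complex^'m^'n \<Rightarrow> complex^'m^'m \<Rightarrow> (complex^'n^'n) set" where
  "ric_dom B R = {X. hermitian X \<and> det (R_at B R X) \<noteq> 0}"

definition ric ::
  "complex^'n^'n \<Rightarrow> complex^'m^'n \<Rightarrow> complex^'m^'m \<Rightarrow> complex^'n^'n \<Rightarrow> complex^'n^'n \<Rightarrow> complex^'n^'n" where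
  "ric A B R H X =
     adj A ** mconj X ** A
     - adj A ** mconj X ** B ** matrix_inv (R_at B R X) ** adj B ** mconj X ** A
     + H"

definition F_at ::
  "complex^'n^'n \<Rightarrow> complex^'m^'n \<Rightarrow> complex^'m^'m \<Rightarrow> complex^'n^'n \<Rightarrow> complex^'n^'m" where
  "F_at A B R X = matrix_inv (R_at B R X) ** adj B ** mconj X ** A"

definition T_at ::
  "complex^'n^'n \<Rightarrow> complex^'m^'n \<Rightarrow> complex^'m^'m \<Rightarrow> complex^'n^'n \<Rightarrow> complex^'n^'n" where
  "T_at A B R X = A - B ** F_at A B R X"

definition That_at ::
  "complex^'n^'n \<Rightarrow> complex^'m^'n \<Rightarrow> complex^'m^'m \<Rightarrow> complex^'n^'n \<Rightarrow> complex^'n^'n" where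
  "That_at A B R X = mconj (T_at A B R X) ** T_at A B R X"

definition set_R_le ::
  "complex^'n^'n \<Rightarrow> complex^'m^'n \<Rightarrow> complex^'m^'m \<Rightarrow> complex^'n^'n \<Rightarrow> (complex^'n^'n) set" where
  "set_R_le A B R H = {X \<in> ric_dom B R. ric A B R H X \<succeq> X}"

definition set_P :: "complex^'m^'n \<Rightarrow> complex^'m^'m \<Rightarrow> (complex^'n^'n) set" where
  "set_P B R = {X \<in> ric_dom B R. posdef (R_at B R X)}"

definition set_T ::
  "complex^'n^'n \<Rightarrow> complex^'m^'n \<Rightarrow> complex^'m^'m \<Rightarrow> (complex^'n^'n) set" where
  "set_T A B R = {X \<in> ric_dom B R. spectral_radius (That_at A B R X) < 1}"

definition set_S_ge ::
  "complex^'n^'n \<Rightarrow> complex^'m^'n \<Rightarrow> complex^'m^'m \<Rightarrow> complex^'n^'n \<Rightarrow> (complex^'n^'n) set" where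
  "set_S_ge A B R H =
     (\<Union>W \<in> set_T A B R.
        {X. hermitian X \<and>
            X - adj (T_at A B R W) ** mconj X ** T_at A B R W
              \<succeq> H + adj (F_at A B R W) ** R ** F_at A B R W})"

definition cdare_solution ::
  "complex^'n^'n \<Rightarrow> complex^'m^'n \<Rightarrow> complex^'m^'m \<Rightarrow> complex^'n^'n \<Rightarrow> complex^'n^'n \<Rightarrow> bool" where
  "cdare_solution A B R H X \<longleftrightarrow>
     hermitian X \<and> X = ric A B R H X \<and> posdef (R_at B R X)"

definition cdare_maximal ::
  "complex^'n^'n \<Rightarrow> complex^'m^'n \<Rightarrow> complex^'m^'m \<Rightarrow> complex^'n^'n \<Rightarrow> complex^'n^'n \<Rightarrow> bool" where
  "cdare_maximal A B R H X \<longleftrightarrow>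
     cdare_solution A B R H X \<and> (\<forall>X'. cdare_solution A B R H X' \<longrightarrow> X \<succeq> X')"

section \<open>Transformed coefficients\<close>

definition A_hat ::
  "complex^'n^'n \<Rightarrow> complex^'m^'n \<Rightarrow> complex^'m^'m \<Rightarrow> complex^'n^'n \<Rightarrow> complex^'n^'n" where
  "A_hat A B R H =
     mconj A ** A - mconj A ** B ** matrix_inv (R_at B R H) ** adj B ** mconj H ** A"

definition B_hat :: "complex^'n^'n \<Rightarrow> complex^'m^'n \<Rightarrow> complex^('m + 'm)^'n" where
  "B_hat A B =
     (\<chi> i j. case j of Inl a \<Rightarrow> mconj B $ i $ a | Inr b \<Rightarrow> (mconj A ** B) $ i $ b)"

definition block_diag ::
  "complex^'a^'a \<Rightarrow> complex^'b^'b \<Rightarrow> complex^('a + 'b)^('a + 'b)" where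
  "block_diag M N =
     (\<chi> i j. case (i, j) of
        (Inl a, Inl a') \<Rightarrow> M $ a $ a'
      | (Inr b, Inr b') \<Rightarrow> N $ b $ b'
      | _ \<Rightarrow> 0)"

definition R_hat ::
  "complex^'m^'n \<Rightarrow> complex^'m^'m \<Rightarrow> complex^'n^'n \<Rightarrow> complex^('m + 'm)^('m + 'm)" where
  "R_hat B R H = block_diag (mconj R) (R_at B R H)"

definition G_hat ::
  "complex^'n^'n \<Rightarrow> complex^'m^'n \<Rightarrow> complex^'m^'m \<Rightarrow> complex^'n^'n \<Rightarrow> complex^'n^'n" where
  "G_hat A B R H = B_hat A B ** matrix_inv (R_hat B R H) ** adj (B_hat A B)"

definition H_hat ::
  "complex^'n^'n \<Rightarrow> complex^'m^'n \<Rightarrow> complex^'m^'m \<Rightarrow> complex^'n^'n \<Rightarrow> complex^'n^'n" where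
  "H_hat A B R H = H + adj A ** mconj H ** matrix_inv (mat 1 + G_of B R ** mconj H) ** A"

section \<open>The accelerated fixed-point iteration\<close>

type_synonym 'n coeffs = "(complex^'n^'n) \<times> (complex^'n^'n) \<times> (complex^'n^'n)"

text \<open>Coefficient triples are \<open>(A, G, H)\<close>. The first argument of \<open>afpi_step\<close> is the triple of the
  outer iteration, the second one the triple with index \<open>l\<close> of the inner iteration.\<close>

fun afpi_step :: "'n coeffs \<Rightarrow> 'n coeffs \<Rightarrow> 'n::finite coeffs" where
  "afpi_step (A, G, H) (Al, Gl, Hl) =
     (let V = matrix_inv (mat 1 + G ** Hl) in
       (Al ** V ** A,
        Gl + Al ** V ** G ** adj Al,
        H + adj A ** Hl ** V ** A))"

text \<open>The inner triple with index \<open>l \<ge> 1\<close>; the outer update has the same form as an inner step,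
  so the next outer triple is the inner triple with index \<open>r\<close>.\<close>

definition afpi_inner :: "'n coeffs \<Rightarrow> nat \<Rightarrow> 'n::finite coeffs" where
  "afpi_inner t l = ((afpi_step t) ^^ (l - 1)) t"

primrec afpi_coeffs :: "nat \<Rightarrow> 'n coeffs \<Rightarrow> nat \<Rightarrow> 'n::finite coeffs" where
  "afpi_coeffs r t 0 = t"
| "afpi_coeffs r t (Suc k) = afpi_inner (afpi_coeffs r t k) r"

fun afpi_Y :: "nat \<Rightarrow> 'n coeffs \<Rightarrow> complex^'n^'n \<Rightarrow> nat \<Rightarrow> complex^'n::finite^'n" where
  "afpi_Y r t Y0 0 = Y0"
| "afpi_Y r t Y0 (Suc k) =
     (case afpi_coeffs r t (Suc k) of (A, G, H) \<Rightarrow>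
        adj A ** Y0 ** matrix_inv (mat 1 + G ** Y0) ** A + H)"

text \<open>\<open>matrix_inv\<close> is total and unspecified on singular matrices. The following predicate says that
  every matrix inverted in the recursion for the coefficients is nonsingular, so that the recursion
  does not break down.\<close>

definition afpi_no_breakdown :: "nat \<Rightarrow> 'n::finite coeffs \<Rightarrow> bool" where
  "afpi_no_breakdown r t \<longleftrightarrow>
     (\<forall>k. \<forall>l \<in> {1..r - 1}.
        case (afpi_coeffs r t k, afpi_inner (afpi_coeffs r t k) l) of
          ((A, G, H), (Al, Gl, Hl)) \<Rightarrow> det (mat 1 + G ** Hl) \<noteq> 0)"

end

theory Submission
  imports Defs "HOL-Computational_Algebra.Fundamental_Theorem_Algebra"
begin

text \<open>
  Completing the square writes the closed-loop operator \<open>X \<mapsto> T\<^sup>H (mconj X) T + F\<^sup>H R F + H\<close>, with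
  \<open>T = A - B F\<close>, as \<open>ric X\<close> plus a term that is positive semidefinite when \<open>R_at B R X\<close> is, and
  that vanishes for the optimal gain \<open>F = F_at X\<close>. Hence \<open>ric\<close> is monotone above the maximal
  solution \<open>X_M\<close>; a conjugate Stein inequality puts every starting value of the set \<open>set_S_ge\<close>
  above \<open>X_M\<close> and above its image, so the iterates of \<open>ric\<close> decrease to a solution that dominates
  \<open>X_M\<close>, that is to \<open>X_M\<close> itself. One update of the coefficients is composition of the associated
  Riccati operators, and the transformed coefficients encode \<open>ric \<circ> ric\<close>; thus the accelerated
  iterate \<open>Y k\<close> is \<open>ric ^^ (2 * r ^ k)\<close> applied to \<open>X0\<close> for \<open>k \<ge> 1\<close>. With the gain of \<open>X_M\<close> the
  closed-loop bound shows that two steps contract the error by the congruence with \<open>That_at X_M\<close>,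
  which gives the rate through the spectral radius formula.
\<close>

section \<open>Conjugation, adjoints and inverses of complex matrices\<close>

lemma matrix_add_rdistrib: "(A + B) ** C = A ** C + B ** (C :: 'a::semiring_1^'p^'n)"
  by (vector matrix_matrix_mult_def sum.distrib[symmetric] distrib_right)

lemma matrix_diff_ldistrib: "A ** (B - C) = A ** B - A ** (C :: 'a::ring_1^'p^'n)"
  by (vector matrix_matrix_mult_def sum_subtractf[symmetric] right_diff_distrib)

lemma matrix_diff_rdistrib: "(A - B) ** C = A ** C - B ** (C :: 'a::ring_1^'p^'n)"
  by (vector matrix_matrix_mult_def sum_subtractf[symmetric] left_diff_distrib)

lemmas matrix_ring = matrix_add_ldistrib matrix_add_rdistrib matrix_diff_ldistrib
  matrix_diff_rdistrib matrix_mul_assoc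

lemma mconj_add: "mconj (A + B) = mconj A + mconj B"
  and mconj_diff: "mconj (A - B) = mconj A - mconj B"
  and mconj_mconj: "mconj (mconj A) = A"
  and mconj_mat_1: "mconj (mat 1) = mat 1"
  by (simp_all add: vec_eq_iff mat_def)

lemma mconj_mult: "mconj (A ** B) = mconj A ** mconj B"
  by (simp add: vec_eq_iff matrix_matrix_mult_def)

lemma adj_nth: "adj M $ i $ j = cnj (M $ j $ i)"
  by (simp add: adj_def transpose_def)

lemma adj_add: "adj (A + B) = adj A + adj B"
  and adj_diff: "adj (A - B) = adj A - adj B"
  and adj_adj: "adj (adj A) = A"
  and adj_mat_1: "adj (mat 1) = mat 1"
  and adj_zero: "adj 0 = 0"
  and adj_mconj: "adj (mconj A) = mconj (adj A)"
  by (auto simp add: vec_eq_iff adj_nth mat_def)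

lemma adj_mult: "adj (A ** B) = adj B ** adj A"
  by (simp add: adj_nth vec_eq_iff matrix_matrix_mult_def mult.commute)

lemmas mconj_simps = mconj_add mconj_diff mconj_mconj mconj_mat_1 mconj_mult
lemmas adj_simps = adj_add adj_diff adj_adj adj_mat_1 adj_mconj adj_mult

lemma hermitian_mconj: "hermitian M \<Longrightarrow> hermitian (mconj M)"
  by (simp add: hermitian_def adj_mconj)

lemma hermitian_add: "hermitian M \<Longrightarrow> hermitian M' \<Longrightarrow> hermitian (M + M')"
  by (simp add: hermitian_def adj_simps)

lemma hermitian_congruence: "hermitian M \<Longrightarrow> hermitian (adj T ** M ** T)"
  by (simp add: hermitian_def adj_simps matrix_mul_assoc)

lemma matrix_inv_nonsingular:
  fixes M :: "'a::field^'n^'n"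
  assumes "det M \<noteq> 0"
  shows "M ** matrix_inv M = mat 1" and "matrix_inv M ** M = mat 1"
proof -
  have "invertible M"
    using assms by (simp add: invertible_det_nz)
  then have "M ** matrix_inv M = mat 1 \<and> matrix_inv M ** M = mat 1"
    unfolding matrix_inv_def invertible_def by (rule someI_ex)
  then show "M ** matrix_inv M = mat 1" "matrix_inv M ** M = mat 1"
    by auto
qed

text \<open>For square matrices over a field a right inverse is two-sided. Exhibiting one therefore
  gives nonsingularity and, with the next lemma, the value of \<open>matrix_inv\<close>.\<close>

lemma right_inverse_det_nonzero:
  fixes M :: "'a::field^'n^'n"
  shows "M ** V = mat 1 \<Longrightarrow> det M \<noteq> 0"
  using invertible_det_nz invertible_right_inverse by blast

lemma right_inverse_unique:
  fixes M :: "'a::field^'n^'n"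
  assumes "M ** V = mat 1"
  shows "matrix_inv M = V"
  using assms matrix_inv_nonsingular(2)[OF right_inverse_det_nonzero[OF assms]]
  by (metis matrix_mul_assoc matrix_mul_lid matrix_mul_rid)

lemma det_nonzero_ker:
  fixes M :: "'a::field^'n^'n"
  shows "det M \<noteq> 0 \<longleftrightarrow> (\<forall>v. M *v v = 0 \<longrightarrow> v = 0)"
  using invertible_det_nz[of M] invertible_left_inverse[of M] matrix_left_invertible_ker[of M]
  by blast

lemma det_mconj_nonzero: "det M \<noteq> 0 \<Longrightarrow> det (mconj M) \<noteq> 0"
  and matrix_inv_mconj: "det M \<noteq> 0 \<Longrightarrow> matrix_inv (mconj M) = mconj (matrix_inv M)"
proof -
  assume "det M \<noteq> 0"
  then have "mconj M ** mconj (matrix_inv M) = mat 1"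
    using matrix_inv_nonsingular(1)[of M] by (metis mconj_mult mconj_mat_1)
  then show "det (mconj M) \<noteq> 0" "matrix_inv (mconj M) = mconj (matrix_inv M)"
    using right_inverse_det_nonzero right_inverse_unique by blast+
qed

lemma matrix_inv_adj: "det M \<noteq> 0 \<Longrightarrow> matrix_inv (adj M) = adj (matrix_inv M)"
proof -
  assume "det M \<noteq> 0"
  then have "adj M ** adj (matrix_inv M) = mat 1"
    using matrix_inv_nonsingular(2)[of M] by (metis adj_mult adj_mat_1)
  then show "matrix_inv (adj M) = adj (matrix_inv M)"
    by (rule right_inverse_unique)
qed

lemma hermitian_matrix_inv: "hermitian M \<Longrightarrow> det M \<noteq> 0 \<Longrightarrow> hermitian (matrix_inv M)"
  using matrix_inv_adj[of M] by (simp add: hermitian_def)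

section \<open>The Loewner order\<close>

lemma quad_form_add: "quad_form (M + M') v = quad_form M v + quad_form M' v"
  by (simp add: quad_form_def matrix_vector_mult_add_rdistrib distrib_left sum.distrib)

lemma adj_dot:
  fixes T :: "complex^'n^'m"
  shows "(\<Sum>i\<in>UNIV. cnj (v $ i) * (adj T *v w) $ i) = (\<Sum>j\<in>UNIV. cnj ((T *v v) $ j) * w $ j)"
proof -
  have "(\<Sum>i\<in>UNIV. cnj (v $ i) * (adj T *v w) $ i)
      = (\<Sum>i\<in>UNIV. \<Sum>j\<in>UNIV. cnj (v $ i) * (cnj (T $ j $ i) * w $ j))"
    by (simp add: matrix_vector_mult_def adj_nth sum_distrib_left)
  also have "\<dots> = (\<Sum>j\<in>UNIV. \<Sum>i\<in>UNIV. cnj (v $ i) * (cnj (T $ j $ i) * w $ j))"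
    by (rule sum.swap)
  also have "\<dots> = (\<Sum>j\<in>UNIV. cnj ((T *v v) $ j) * w $ j)"
    by (simp add: matrix_vector_mult_def sum_distrib_left sum_distrib_right mult_ac)
  finally show ?thesis .
qed

text \<open>Moving \<open>adj T\<close> across the inner product turns a congruence into a change of
  the test vector. \<open>T\<close> may be rectangular, so this also covers terms such as
  \<open>adj B ** M ** B\<close>.\<close>

lemma quad_form_congruence: "quad_form (adj T ** M ** T) v = quad_form M (T *v v)"
proof -
  have "(adj T ** M ** T) *v v = adj T *v (M *v (T *v v))"
    by (simp add: matrix_vector_mul_assoc matrix_mul_assoc)
  then show ?thesis
    by (simp only: quad_form_def adj_dot)
qed

text \<open>Conjugating the entries conjugates the test vector and the value. The real part keeps
  its sign over all vectors, so the conjugations in the Riccati operator respect the Loewner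
  order.\<close>

lemma quad_form_mconj: "quad_form (mconj M) v = cnj (quad_form M (\<chi> i. cnj (v $ i)))"
  by (simp add: quad_form_def matrix_vector_mult_def)

lemma matrix_vector_axis: "(M *v axis j c) $ i = (M $ i $ j * c :: 'a::semiring_1)"
proof -
  have "(M *v axis j c) $ i = (\<Sum>l\<in>UNIV. if l = j then M $ i $ l * c else 0)"
    unfolding matrix_vector_mult_def vec_lambda_beta by (rule sum.cong) (auto simp: axis_def)
  then show ?thesis
    by simp
qed

lemma quad_form_axis: "quad_form M (axis i 1) = M $ i $ i"
proof -
  have "quad_form M (axis i 1) = (\<Sum>k\<in>UNIV. if k = i then M $ k $ i else 0)"
    unfolding quad_form_def by (rule sum.cong) (auto simp: matrix_vector_axis, auto simp: axis_def)
  then show ?thesis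
    by simp
qed

text \<open>A test vector supported on two coordinates exposes an off-diagonal entry, multiplied by
  a phase that is still free.\<close>

lemma quad_form_axis_add:
  assumes "i \<noteq> j"
  shows "quad_form M (axis i 1 + axis j c)
    = M $ i $ i + c * M $ i $ j + cnj c * M $ j $ i + cnj c * c * M $ j $ j"
proof -
  have "quad_form M (axis i 1 + axis j c)
     = (\<Sum>k\<in>UNIV. (if k = i then M $ k $ i + c * M $ k $ j else 0)
        + (if k = j then cnj c * (M $ k $ i + c * M $ k $ j) else 0))"
    unfolding quad_form_def matrix_vector_right_distrib vector_add_component matrix_vector_axis
    by (auto simp: axis_def algebra_simps intro!: sum.cong)
  also have "\<dots> = M $ i $ i + c * M $ i $ j + cnj c * (M $ j $ i + c * M $ j $ j)"
    by (simp add: sum.distrib)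
  finally show ?thesis
    by (simp add: algebra_simps)
qed

lemma psd_hermitian: "psd M \<Longrightarrow> hermitian M"
  by (simp add: psd_def)

lemma psd_zero: "psd 0"
  by (simp add: psd_def hermitian_def adj_zero quad_form_def)

lemma psd_add: "psd M \<Longrightarrow> psd M' \<Longrightarrow> psd (M + M')"
  by (simp add: psd_def hermitian_add quad_form_add)

lemma psd_congruence: "psd M \<Longrightarrow> psd (adj T ** M ** T)"
  by (simp add: psd_def hermitian_congruence quad_form_congruence)

lemma psd_mconj: "psd M \<Longrightarrow> psd (mconj M)"
  by (simp add: psd_def hermitian_mconj quad_form_mconj)

lemma posdef_psd: "posdef M \<Longrightarrow> psd M"
proof -
  \<comment> \<open>\<open>posdef\<close> says nothing about the zero vector, so its value is
    supplied separately.\<close>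
  have "0 \<le> Re (quad_form M 0)"
    by (simp add: quad_form_def)
  then show "posdef M \<Longrightarrow> psd M"
    unfolding posdef_def psd_def by (metis less_imp_le)
qed

lemma posdef_add_psd: "posdef M \<Longrightarrow> psd M' \<Longrightarrow> posdef (M + M')"
  unfolding posdef_def psd_def by (simp add: hermitian_add quad_form_add add_pos_nonneg)

lemma posdef_det_nonzero: "posdef M \<Longrightarrow> det M \<noteq> 0"
  unfolding det_nonzero_ker posdef_def by (force simp: quad_form_def)

lemma loewner_refl: "M \<succeq> M"
  by (simp add: loewner_ge_def psd_zero)

lemma loewner_trans: "L \<succeq> M \<Longrightarrow> M \<succeq> K \<Longrightarrow> L \<succeq> K"
  unfolding loewner_ge_def using psd_add[of "L - M" "M - K"] by simp

section \<open>Trace bounds for positive semidefinite matrices\<close>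

lemma psd_diag_nonneg: "psd M \<Longrightarrow> 0 \<le> Re (M $ i $ i)"
  unfolding psd_def using quad_form_axis[of M i] by metis

text \<open>A scalar gauge for the Loewner order: additive, nonnegative on the semidefinite cone
  and, there, an upper bound for every entry.\<close>

definition re_trace :: "complex^'n^'n \<Rightarrow> real" where
  "re_trace M = (\<Sum>i\<in>UNIV. Re (M $ i $ i))"

lemma re_trace_diff: "re_trace (M - M') = re_trace M - re_trace M'"
  by (simp add: re_trace_def sum_subtractf)

lemma re_trace_nonneg: "psd M \<Longrightarrow> 0 \<le> re_trace M"
  by (simp add: re_trace_def psd_diag_nonneg sum_nonneg)

text \<open>Evaluate the quadratic form at \<open>e\<^sub>i + c e\<^sub>j\<close>, where \<open>c\<close> is the phase that turns
  \<open>c M\<^sub>i\<^sub>j\<close> into \<open>- \<bar>M\<^sub>i\<^sub>j\<bar>\<close>.\<close>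

lemma psd_entry_le_re_trace:
  assumes "psd M"
  shows "cmod (M $ i $ j) \<le> re_trace M"
proof (cases "i = j")
  case True
  have "M $ i $ i = cnj (M $ i $ i)"
    using assms adj_nth[of M i i] by (simp add: psd_def hermitian_def)
  then have "cmod (M $ i $ i) = \<bar>Re (M $ i $ i)\<bar>"
    by (metis cmod_eq_Re complex.sel(2) cnj.simps(2) neg_equal_zero)
  also have "\<dots> = Re (M $ i $ i)"
    using psd_diag_nonneg[OF assms] by simp
  also have "\<dots> \<le> re_trace M"
    unfolding re_trace_def
    using member_le_sum[of i UNIV "\<lambda>i. Re (M $ i $ i)"] psd_diag_nonneg[OF assms] by auto
  finally show ?thesis
    using True by simp
next
  case False
  define z where "z = M $ i $ j"
  \<comment> \<open>\<open>sgn z\<close> vanishes together with \<open>z\<close>; the fallback value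
    1 keeps \<open>c\<close> of modulus one.\<close>
  define c where "c = (if z = 0 then 1 else - cnj (sgn z))"
  have cz: "c * z = - of_real (cmod z)"
    by (auto simp: c_def sgn_div_norm scaleR_conv_of_real field_simps complex_norm_square[symmetric]
        power2_eq_square)
  have cc: "cnj c * c = 1"
    using complex_norm_square[of "sgn z"] by (auto simp: c_def norm_sgn mult.commute)
  have ji: "M $ j $ i = cnj z"
    using assms adj_nth[of M j i] by (simp add: psd_def hermitian_def z_def)
  have "Re (cnj c * cnj z) = Re (c * z)"
    by (metis complex_cnj_mult cnj.simps(1))
  then have "Re (quad_form M (axis i 1 + axis j c)) = Re (M $ i $ i) + Re (M $ j $ j) - 2 * cmod z"
    using cz cc by (simp add: quad_form_axis_add[OF False] ji flip: z_def)
  then have "2 * cmod z \<le> Re (M $ i $ i) + Re (M $ j $ j)"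
    using assms unfolding psd_def by (metis diff_ge_0_iff_ge)
  also have "\<dots> = (\<Sum>k\<in>{i,j}. Re (M $ k $ k))"
    using False by simp
  also have "\<dots> \<le> re_trace M"
    unfolding re_trace_def by (rule sum_mono2) (auto simp: psd_diag_nonneg[OF assms])
  finally have "2 * cmod z \<le> re_trace M" .
  then show ?thesis
    by (smt (verit) norm_ge_zero z_def)
qed

text \<open>The semidefinite difference \<open>M - M'\<close> has trace at most zero, because its
  negative is semidefinite too, and the trace bounds every entry.\<close>

lemma loewner_antisym:
  assumes "M \<succeq> M'" "M' \<succeq> M"
  shows "M = M'"
proof -
  have "re_trace (M - M') \<le> 0"
    using re_trace_nonneg[of "M' - M"] assms(2) by (simp add: loewner_ge_def re_trace_diff)
  then have "cmod ((M - M') $ i $ j) \<le> 0" for i j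
    using psd_entry_le_re_trace[of "M - M'" i j] assms(1) unfolding loewner_ge_def by linarith
  then show ?thesis
    by (simp add: vec_eq_iff)
qed

lemma norm_matrix_le_entries:
  fixes M :: "complex^'n^'m"
  assumes "\<And>i j. cmod (M $ i $ j) \<le> c"
  shows "norm M \<le> real CARD('m) * real CARD('n) * c"
proof -
  have "norm M \<le> (\<Sum>i\<in>UNIV. norm (M $ i))"
    unfolding norm_vec_def[of M] by (rule L2_set_le_sum) simp
  also have "\<dots> \<le> (\<Sum>i::'m\<in>UNIV. \<Sum>j::'n\<in>UNIV. c)"
    unfolding norm_vec_def by (intro sum_mono order_trans[OF L2_set_le_sum] norm_ge_zero) (rule assms)
  finally show ?thesis
    by simp
qed

lemma psd_norm_le_re_trace:
  fixes M :: "complex^'n^'n"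
  assumes "psd M"
  shows "norm M \<le> real CARD('n) * real CARD('n) * re_trace M"
  by (rule norm_matrix_le_entries) (rule psd_entry_le_re_trace[OF assms])

lemma re_trace_le_norm:
  fixes M :: "complex^'n^'n"
  shows "re_trace M \<le> real CARD('n) * norm M"
proof -
  have "Re (M $ i $ i) \<le> norm M" for i
    using complex_Re_le_cmod[of "M $ i $ i"] Finite_Cartesian_Product.norm_nth_le[of M i]
      Finite_Cartesian_Product.norm_nth_le[of "M $ i" i]
    by linarith
  then show ?thesis
    unfolding re_trace_def using sum_bounded_above[of UNIV "\<lambda>i. Re (M $ i $ i)" "norm M"] by simp
qed

text \<open>Turns order bounds on the error into norm bounds. The trace is monotone; comparing the
  norm with it costs a factor \<open>n^2\<close> in one direction and \<open>n\<close> in the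
  other.\<close>

lemma loewner_norm_le:
  fixes M M' :: "complex^'n^'n"
  assumes "psd M" "M' \<succeq> M"
  shows "norm M \<le> real CARD('n) ^ 3 * norm M'"
proof -
  have "norm M \<le> real CARD('n) * real CARD('n) * re_trace M"
    by (rule psd_norm_le_re_trace[OF assms(1)])
  also have "\<dots> \<le> real CARD('n) * real CARD('n) * (real CARD('n) * norm M')"
    using re_trace_nonneg[of "M' - M"] re_trace_le_norm[of M'] assms(2)
    by (intro mult_left_mono) (simp_all add: loewner_ge_def re_trace_diff)
  finally show ?thesis
    by (simp add: power3_eq_cube mult_ac)
qed

section \<open>Limits and monotone convergence in the Loewner order\<close>

lemma psd_tendsto:
  assumes "(f \<longlongrightarrow> L) F" "F \<noteq> bot" "\<forall>\<^sub>F x in F. psd (f x)"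
  shows "psd L"
proof -
  have entry: "((\<lambda>x. f x $ i $ j) \<longlongrightarrow> L $ i $ j) F" for i j
    by (intro tendsto_intros assms(1))
  have "cnj (L $ j $ i) = L $ i $ j" for i j
  proof (rule tendsto_unique[OF assms(2) _ entry])
    have "((\<lambda>x. cnj (f x $ j $ i)) \<longlongrightarrow> cnj (L $ j $ i)) F"
      by (intro tendsto_intros entry)
    then show "((\<lambda>x. f x $ i $ j) \<longlongrightarrow> cnj (L $ j $ i)) F"
      by (rule tendsto_cong[THEN iffD1, rotated])
        (use assms(3) in eventually_elim, metis psd_def hermitian_def adj_nth)
  qed
  moreover have "0 \<le> Re (quad_form L v)" for v
  proof (rule tendsto_lowerbound[OF _ _ assms(2)])
    show "((\<lambda>x. Re (quad_form (f x) v)) \<longlongrightarrow> Re (quad_form L v)) F"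
      unfolding quad_form_def matrix_vector_mult_def vec_lambda_beta
      by (intro tendsto_intros entry)
    show "\<forall>\<^sub>F x in F. 0 \<le> Re (quad_form (f x) v)"
      using assms(3) by eventually_elim (simp add: psd_def)
  qed
  ultimately show ?thesis
    by (simp add: psd_def hermitian_def vec_eq_iff adj_nth)
qed

lemma loewner_tendsto:
  assumes "(f \<longlongrightarrow> L) F" "(g \<longlongrightarrow> K) F" "F \<noteq> bot" "\<forall>\<^sub>F x in F. f x \<succeq> g x"
  shows "L \<succeq> K"
  unfolding loewner_ge_def
  by (rule psd_tendsto[OF tendsto_diff[OF assms(1,2)] assms(3)]) (use assms(4) in \<open>simp add: loewner_ge_def\<close>)

lemma loewner_decreasing:
  assumes "\<And>k. X k \<succeq> X (Suc k)" "j \<le> k"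
  shows "X j \<succeq> X k"
  using assms(2) by (induction k rule: dec_induct) (auto intro: loewner_refl loewner_trans assms(1))

text \<open>A bounded decreasing sequence is Cauchy because its traces are.\<close>

lemma loewner_decreasing_convergent:
  fixes X :: "nat \<Rightarrow> complex^'n^'n"
  assumes dec: "\<And>k. X k \<succeq> X (Suc k)" and lb: "\<And>k. X k \<succeq> L"
  shows "convergent X"
proof -
  define c where "c = real CARD('n) * real CARD('n)"
  have mono: "X m \<succeq> X n" if "m \<le> n" for m n
    using dec that by (rule loewner_decreasing)
  have "Cauchy (\<lambda>k. re_trace (X k))"
  proof (rule convergent_Cauchy, rule monoseq_imp_convergent_iff_Bseq[THEN iffD2])
    have tr: "re_trace (X n) \<le> re_trace (X m)" if "m \<le> n" for m n
      using re_trace_nonneg[of "X m - X n"] mono[OF that] by (simp add: loewner_ge_def re_trace_diff)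
    then show "monoseq (\<lambda>k. re_trace (X k))"
      by (simp add: monoseq_def)
    have "re_trace L \<le> re_trace (X k)" for k
      using re_trace_nonneg[of "X k - L"] lb[of k] by (simp add: loewner_ge_def re_trace_diff)
    moreover have "re_trace (X k) \<le> re_trace (X 0)" for k
      by (simp add: tr)
    ultimately have "\<bar>re_trace (X k)\<bar> \<le> \<bar>re_trace L\<bar> + \<bar>re_trace (X 0)\<bar>" for k
      by (smt (verit))
    then show "Bseq (\<lambda>k. re_trace (X k))"
      by (auto intro!: BseqI')
  qed
  \<comment> \<open>The difference is semidefinite, so its norm is at most \<open>c\<close> times
    its trace, and that trace is the distance between the two traces.\<close>
  have le: "dist (X m) (X n) \<le> c * dist (re_trace (X m)) (re_trace (X n))" if "m \<le> n" for m n
    using psd_norm_le_re_trace[of "X m - X n"] mono[OF that] re_trace_nonneg[of "X m - X n"]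
    by (simp add: c_def loewner_ge_def dist_norm re_trace_diff)
  have le: "dist (X m) (X n) \<le> c * dist (re_trace (X m)) (re_trace (X n))" for m n
    using le[of m n] le[of n m] by (cases "m \<le> n") (auto simp: dist_commute)
  have "c > 0"
    by (simp add: c_def)
  have "Cauchy X"
  proof (rule metric_CauchyI)
    fix e :: real assume "e > 0"
    then obtain M where "\<forall>m\<ge>M. \<forall>n\<ge>M. dist (re_trace (X m)) (re_trace (X n)) < e / c"
      using \<open>Cauchy (\<lambda>k. re_trace (X k))\<close> \<open>c > 0\<close> unfolding Cauchy_def
      by (metis divide_pos_pos)
    then show "\<exists>M. \<forall>m\<ge>M. \<forall>n\<ge>M. dist (X m) (X n) < e"
      using le \<open>c > 0\<close> by (metis le_less_trans mult.commute pos_less_divide_eq)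
  qed
  then show ?thesis
    by (rule Cauchy_convergent)
qed

section \<open>Powers of a matrix and the spectral radius\<close>

text \<open>On this type \<open>^\<close> is the entrywise power, hence a separate recursion for
  powers with respect to \<open>**\<close>.\<close>

primrec mat_pow :: "complex^'n^'n \<Rightarrow> nat \<Rightarrow> complex^'n^'n" where
  "mat_pow M 0 = mat 1"
| "mat_pow M (Suc k) = M ** mat_pow M k"

lemma mat_pow_commute: "mat_pow M k ** M = M ** mat_pow M k"
  by (induction k) (simp_all add: flip: matrix_mul_assoc)

lemma scaleR_mult_left: "(c *\<^sub>R A) ** B = c *\<^sub>R (A ** (B :: complex^'p^'n))"
  and scaleR_mult_right: "A ** (c *\<^sub>R B) = c *\<^sub>R (A ** B)"
  by (simp_all add: vec_eq_iff matrix_matrix_mult_def scaleR_sum_right)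

lemma scaleR_mult_vec: "(c *\<^sub>R A) *v v = c *\<^sub>R (A *v (v :: complex^'n))"
  by (simp add: vec_eq_iff matrix_vector_mult_def scaleR_sum_right)

lemma mat_pow_scaleR: "mat_pow (c *\<^sub>R M) k = c ^ k *\<^sub>R mat_pow M k"
  by (induction k) (simp_all add: scaleR_mult_left scaleR_mult_right)

lemma matrix_vector_mult_smult: "M *v (c *s v) = c *s (M *v (v :: complex^'n))"
  by (simp add: vec_eq_iff matrix_vector_mult_def sum_distrib_left mult_ac)

text \<open>The vector \<open>p(M) v\<close>. Applying \<open>p(M)\<close> to a vector, rather than
  forming the matrix, suits arguments that strip off one linear factor at a time.\<close>

definition poly_mat_vec :: "complex poly \<Rightarrow> complex^'n^'n \<Rightarrow> complex^'n \<Rightarrow> complex^'n" where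
  "poly_mat_vec p M v = (\<Sum>i\<le>degree p. coeff p i *s (mat_pow M i *v v))"

text \<open>Coefficients beyond the degree vanish, so different polynomials can be expanded over one
  common index range.\<close>

lemma poly_mat_vec_bound:
  assumes "degree p \<le> n"
  shows "poly_mat_vec p M v = (\<Sum>i\<le>n. coeff p i *s (mat_pow M i *v v))"
  unfolding poly_mat_vec_def
  by (rule sum.mono_neutral_left) (use assms in \<open>auto simp: coeff_eq_0\<close>)

lemma poly_mat_vec_const: "poly_mat_vec [:c:] M v = c *s v"
  by (simp add: poly_mat_vec_def)

lemma poly_mat_vec_pCons: "poly_mat_vec (pCons a p) M v = a *s v + poly_mat_vec p M (M *v v)"
proof -
  have "poly_mat_vec (pCons a p) M v
      = (\<Sum>i\<le>Suc (degree p). coeff (pCons a p) i *s (mat_pow M i *v v))"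
    by (rule poly_mat_vec_bound) (rule degree_pCons_le)
  also have "\<dots> = a *s v + poly_mat_vec p M (M *v v)"
    by (subst sum.atMost_Suc_shift)
      (simp add: poly_mat_vec_def matrix_vector_mul_assoc mat_pow_commute)
  finally show ?thesis .
qed

lemma poly_mat_vec_diff: "poly_mat_vec (p - q) M v = poly_mat_vec p M v - poly_mat_vec q M v"
proof -
  define n where "n = max (degree p) (degree q)"
  have "degree p \<le> n" "degree q \<le> n" "degree (p - q) \<le> n"
    by (auto simp: n_def degree_diff_le)
  then show ?thesis
    by (simp add: poly_mat_vec_bound[of _ n] vec.scale_left_diff_distrib sum_subtractf)
qed

lemma poly_mat_vec_smult: "poly_mat_vec (smult c p) M v = c *s poly_mat_vec p M v"
  by (simp add: poly_mat_vec_bound[of _ "degree p"] degree_smult_le vec.scale_sum_right)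

lemma poly_mat_vec_apply: "poly_mat_vec p M (M *v v) = M *v poly_mat_vec p M v"
  by (simp add: poly_mat_vec_def matrix_vector_mul_assoc mat_pow_commute matrix_vector_mult_smult
      vec.linear_sum[OF matrix_vector_mul_linear_gen])

lemma poly_mat_vec_eigenvector:
  assumes "M *v v = c *s v"
  shows "poly_mat_vec p M v = poly p c *s v"
proof -
  have "mat_pow M k *v v = c ^ k *s v" for k
    by (induction k) (simp_all add: assms matrix_vector_mult_smult vector_smult_assoc mult.commute
        flip: matrix_vector_mul_assoc)
  then show ?thesis
    by (simp add: poly_mat_vec_def poly_altdef vector_smult_assoc vec.scale_sum_left)
qed

text \<open>This is \<open>((x - c) q)(M) v = (M - c) q(M) v\<close>. When it vanishes,
  \<open>q(M) v\<close> is either zero or an eigenvector for \<open>c\<close>.\<close>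

lemma poly_mat_vec_linear_factor:
  "poly_mat_vec (pCons 0 q - smult c q) M v = M *v poly_mat_vec q M v - c *s poly_mat_vec q M v"
  by (simp add: poly_mat_vec_diff poly_mat_vec_smult poly_mat_vec_pCons poly_mat_vec_apply)

text \<open>\<open>pCons 0 q - smult c q\<close> is the simplifier's form of the product \<open>[:-c, 1:] * q\<close>.\<close>

lemma complex_poly_induct [consumes 1, case_names const factor]:
  fixes p :: "complex poly"
  assumes "p \<noteq> 0"
    and "\<And>c. c \<noteq> 0 \<Longrightarrow> P [:c:]"
    and "\<And>c q. q \<noteq> 0 \<Longrightarrow> P q \<Longrightarrow> P (pCons 0 q - smult c q)"
  shows "P p"
  using assms(1)
proof (induction "degree p" arbitrary: p)
  case 0
  then show ?case
    using assms(2) by (metis degree_eq_zeroE pCons_0_0)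
next
  case (Suc n)
  then have "\<not> constant (poly p)"
    by (simp add: constant_degree)
  then obtain c where "poly p c = 0"
    using fundamental_theorem_of_algebra by blast
  then obtain q where q: "p = [:-c, 1:] * q"
    unfolding poly_eq_0_iff_dvd by (rule dvdE)
  with Suc have "q \<noteq> 0" "degree q = n"
    by (auto simp: degree_mult_eq simp del: mult_pCons_left)
  then show ?case
    using Suc q assms(3)[of q c] by simp
qed

text \<open>The powers of \<open>M\<close> with exponents \<open>0\<close> to \<open>d\<close> are
  one more than the real dimension \<open>d\<close> of the matrix space, so some nontrivial real
  combination of them vanishes.\<close>

lemma annihilating_poly:
  fixes M :: "complex^'n^'n"
  shows "\<exists>p. p \<noteq> 0 \<and> (\<forall>v. poly_mat_vec p M v = 0)"
proof -
  define d where "d = DIM(complex^'n^'n)"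
  obtain u :: "nat \<Rightarrow> real" where u: "(\<Sum>i\<le>d. u i *\<^sub>R mat_pow M i) = 0" "\<exists>i\<le>d. u i \<noteq> 0"
  proof (cases "inj_on (mat_pow M) {..d}")
    case True
    then have "card (mat_pow M ` {..d}) > DIM(complex^'n^'n)"
      by (simp add: card_image d_def)
    then have "dependent (mat_pow M ` {..d})"
      by (rule dependent_biggerset)
    then obtain w where w: "\<exists>x\<in>mat_pow M ` {..d}. w x \<noteq> 0" "(\<Sum>x\<in>mat_pow M ` {..d}. w x *\<^sub>R x) = 0"
      by (subst (asm) dependent_finite) auto
    show ?thesis
      by (rule that[of "\<lambda>i. w (mat_pow M i)"]) (use w True in \<open>auto simp: sum.reindex\<close>)
  next
    case False
    then obtain i j where ij: "i \<le> d" "j \<le> d" "i \<noteq> j" "mat_pow M i = mat_pow M j"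
      by (auto simp: inj_on_def)
    \<comment> \<open>If two powers coincide, their difference is the required combination; the
      dimension count works with sets and does not see repetitions.\<close>
    define u :: "nat \<Rightarrow> real" where "u k = (if k = i then 1 else 0) - (if k = j then 1 else 0)" for k
    have "(\<Sum>k\<le>d. u k *\<^sub>R mat_pow M k) = (\<Sum>k\<le>d. (if k = i then mat_pow M k else 0) - (if k = j then mat_pow M k else 0))"
      by (rule sum.cong) (auto simp: u_def)
    also have "\<dots> = 0"
      using ij by (simp add: sum_subtractf)
    finally show ?thesis
      by (rule that) (use ij in \<open>auto simp: u_def\<close>)
  qed
  define p where "p = (\<Sum>i\<le>d. monom (complex_of_real (u i)) i)"
  have coeff: "coeff p i = (if i \<le> d then complex_of_real (u i) else 0)" for i
    by (simp add: p_def coeff_sum)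
  have deg: "degree p \<le> d"
    by (rule degree_le) (simp add: coeff)
  have "poly_mat_vec p M v = (\<Sum>i\<le>d. u i *\<^sub>R mat_pow M i) *v v" for v
  proof -
    have smult: "complex_of_real c *s x = c *\<^sub>R x" for c :: real and x :: "complex^'n"
      by (simp add: vec_eq_iff) (simp add: scaleR_conv_of_real)
    have "(\<Sum>i\<le>n. u i *\<^sub>R mat_pow M i) *v v = (\<Sum>i\<le>n. u i *\<^sub>R (mat_pow M i *v v))" for n
      by (induction n) (simp_all add: matrix_vector_mult_add_rdistrib scaleR_mult_vec)
    then show ?thesis
      by (simp add: poly_mat_vec_bound[OF deg] coeff smult)
  qed
  then have "\<And>v. poly_mat_vec p M v = 0"
    using u by simp
  moreover have "p \<noteq> 0"
    using u(2) coeff by (metis coeff_0 of_real_eq_0_iff)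
  ultimately show ?thesis
    by blast
qed

text \<open>Every eigenvalue is a root of an annihilating polynomial. Finiteness gives the
  \<open>Max\<close> in \<open>spectral_radius\<close> its meaning.\<close>

lemma finite_eigenvalues: "finite {c. \<exists>v. v \<noteq> 0 \<and> M *v v = c *s (v :: complex^'n)}"
proof -
  obtain p where p: "p \<noteq> 0" "\<And>v. poly_mat_vec p M v = 0"
    using annihilating_poly[of M] by blast
  have "{c. \<exists>v. v \<noteq> 0 \<and> M *v v = c *s v} \<subseteq> {c. poly p c = 0}"
  proof safe
    fix c and v :: "complex^'n" assume "v \<noteq> 0" "M *v v = c *s v"
    then show "poly p c = 0"
      using p(2)[of v] by (simp add: poly_mat_vec_eigenvector)
  qed
  then show ?thesis
    using poly_roots_finite[OF p(1)] finite_subset by blast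
qed

text \<open>Strip linear factors off an annihilating polynomial: the first factor that sends a
  nonzero vector to zero yields an eigenvector. Hence \<open>Max\<close> is taken over a nonempty
  set.\<close>

lemma eigenvalue_exists:
  fixes M :: "complex^'n^'n"
  shows "\<exists>c v. v \<noteq> 0 \<and> M *v v = c *s v"
proof -
  have *: "\<exists>c v. v \<noteq> 0 \<and> M *v v = c *s v" if "p \<noteq> 0" "v \<noteq> 0" "poly_mat_vec p M v = 0" for p v
    using that
  proof (induction p rule: complex_poly_induct)
    case (const c)
    then show ?case
      by (auto simp: poly_mat_vec_const)
  next
    case (factor c q)
    then show ?case
      by (cases "poly_mat_vec q M v = 0") (auto simp: poly_mat_vec_linear_factor)
  qed
  obtain p where "p \<noteq> 0" "\<And>v. poly_mat_vec p M v = 0"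
    using annihilating_poly[of M] by blast
  \<comment> \<open>Here \<open>1\<close> is the vector of ones, taken merely as some nonzero
    vector.\<close>
  moreover have "(1 :: complex^'n) \<noteq> 0"
    by simp
  ultimately show ?thesis
    using * by blast
qed

lemma eigenvalue_le_spectral_radius:
  assumes "v \<noteq> 0" "M *v v = c *s (v :: complex^'n)"
  shows "cmod c \<le> spectral_radius M"
proof -
  have "{cmod c | c. \<exists>v. v \<noteq> 0 \<and> M *v v = c *s v} = cmod ` {c. \<exists>v. v \<noteq> 0 \<and> M *v v = c *s v}"
    by auto
  then have "finite {cmod c | c. \<exists>v. v \<noteq> 0 \<and> M *v v = c *s v}"
    using finite_eigenvalues[of M] by simp
  then show ?thesis
    unfolding spectral_radius_def using assms by (intro Max_ge) auto
qed

lemma spectral_radius_nonneg: "0 \<le> spectral_radius (M :: complex^'n^'n)"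
  using eigenvalue_exists[of M] eigenvalue_le_spectral_radius[of _ M] norm_ge_zero order_trans
  by metis

text \<open>A contraction with vanishing forcing: the old state decays geometrically, and late
  forcing terms accumulate only as a geometric series.\<close>

lemma linear_recurrence_tendsto_zero:
  fixes x w :: "nat \<Rightarrow> complex^'n"
  assumes "cmod c < 1" "w \<longlonglongrightarrow> 0" and step: "\<And>k. x (Suc k) = c *s x k + w k"
  shows "x \<longlonglongrightarrow> 0"
proof -
  have norm_smult: "norm (c *s v) = cmod c * norm v" for v :: "complex^'n"
    by (simp add: norm_vec_def norm_mult L2_set_right_distrib)
  have "norm (x (Suc k)) \<le> cmod c * norm (x k) + norm (w k)" for k
    using norm_triangle_ineq[of "c *s x k" "w k"] by (simp add: step norm_smult)
  note rec = this
  show ?thesis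
  proof (rule LIMSEQ_I)
    fix e :: real assume e: "e > 0"
    define a where "a = cmod c"
    have a: "0 \<le> a" "a < 1"
      using assms(1) by (auto simp: a_def)
    \<comment> \<open>The factor \<open>1 - a\<close> compensates the geometric series, so that the
      accumulated forcing stays below \<open>e / 2\<close>.\<close>
    obtain K where K: "\<And>k. k \<ge> K \<Longrightarrow> norm (w k) < e / 2 * (1 - a)"
      using LIMSEQ_D[OF assms(2), of "e / 2 * (1 - a)"] e a by auto
    have bd: "norm (x (K + j)) \<le> a ^ j * norm (x K) + e / 2" for j
    proof (induction j)
      case (Suc j)
      have "norm (x (K + Suc j)) \<le> a * norm (x (K + j)) + e / 2 * (1 - a)"
        using rec[of "K + j"] K[of "K + j"] by (simp add: a_def)
      also have "\<dots> \<le> a * (a ^ j * norm (x K) + e / 2) + e / 2 * (1 - a)"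
        using Suc a by (simp add: mult_left_mono)
      also have "\<dots> = a ^ Suc j * norm (x K) + e / 2"
        by (simp add: field_simps)
      finally show ?case .
    qed (use e in simp)
    have "(\<lambda>j. a ^ j * norm (x K)) \<longlonglongrightarrow> 0"
      using tendsto_mult_left_zero[OF LIMSEQ_power_zero[of a]] a by simp
    then obtain J where J0: "\<forall>j\<ge>J. norm (a ^ j * norm (x K) - 0) < e / 2"
      using LIMSEQ_D e half_gt_zero by blast
    have J: "a ^ j * norm (x K) < e / 2" if "j \<ge> J" for j
      using J0 that abs_ge_self[of "a ^ j * norm (x K)"] by (metis diff_zero le_less_trans real_norm_def)
    have "norm (x n - 0) < e" if "n \<ge> K + J" for n
    proof -
      have "a ^ (n - K) * norm (x K) < e / 2"
        using that by (intro J) simp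
      then show ?thesis
        using bd[of "n - K"] that by simp
    qed
    then show "\<exists>n0. \<forall>n\<ge>n0. norm (x n - 0) < e"
      by blast
  qed
qed

text \<open>Split an annihilating polynomial into linear factors \<open>M - c\<close>: a factor whose root is not an
  eigenvalue is injective and can be dropped, the others have \<open>\<bar>c\<bar> < 1\<close>.\<close>

lemma mat_pow_tendsto_zero:
  fixes M :: "complex^'n^'n"
  assumes "\<And>c v. v \<noteq> 0 \<Longrightarrow> M *v v = c *s v \<Longrightarrow> cmod c < 1"
  shows "mat_pow M \<longlonglongrightarrow> 0"
proof -
  have *: "(\<lambda>k. mat_pow M k *v v) \<longlonglongrightarrow> 0" if "p \<noteq> 0" "poly_mat_vec p M v = 0" for p v
    using that
  proof (induction p arbitrary: v rule: complex_poly_induct)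
    case (const c)
    then show ?case
      by (simp add: poly_mat_vec_const)
  next
    case (factor c q)
    show ?case
    proof (cases "poly_mat_vec q M v = 0")
      case True
      then show ?thesis
        by (rule factor.IH)
    next
      case False
      then have c: "cmod c < 1"
        using factor.prems assms[of "poly_mat_vec q M v" c] by (simp add: poly_mat_vec_linear_factor)
      \<comment> \<open>Since \<open>q(M) w\<close> is the full polynomial applied to
        \<open>v\<close>, the induction hypothesis covers \<open>w\<close>; its orbit is the forcing
        term in the recurrence for the orbit of \<open>v\<close>.\<close>
      define w where "w = M *v v - c *s v"
      have "poly_mat_vec q M w = M *v poly_mat_vec q M v - c *s poly_mat_vec q M v"
        unfolding w_def poly_mat_vec_apply[symmetric]
        by (simp add: poly_mat_vec_def matrix_vector_mult_diff_distrib matrix_vector_mult_smult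
            vec.scale_right_diff_distrib sum_subtractf vec.scale_sum_right vector_smult_assoc mult_ac)
      then have w0: "(\<lambda>k. mat_pow M k *v w) \<longlonglongrightarrow> 0"
        using factor.prems by (intro factor.IH) (simp add: poly_mat_vec_linear_factor)
      show ?thesis
      proof (rule linear_recurrence_tendsto_zero[OF c w0])
        have "mat_pow M (Suc k) *v v = mat_pow M k *v (M *v v)" for k
          by (simp add: matrix_vector_mul_assoc mat_pow_commute)
        then show "mat_pow M (Suc k) *v v = c *s (mat_pow M k *v v) + mat_pow M k *v w" for k
          by (simp add: w_def matrix_vector_mult_diff_distrib matrix_vector_mult_smult)
      qed
    qed
  qed
  obtain p where "p \<noteq> 0" "\<And>v. poly_mat_vec p M v = 0"
    using annihilating_poly[of M] by blast
  then have col: "(\<lambda>k. mat_pow M k *v axis j 1) \<longlonglongrightarrow> 0" for j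
    using * by blast
  have "(\<lambda>k. mat_pow M k $ i $ j) \<longlonglongrightarrow> 0 $ i $ j" for i j
    using tendsto_vec_nth[OF col[of j], of i] by (simp add: matrix_vector_axis)
  then show ?thesis
    by (intro vec_tendstoI)
qed

lemma mat_pow_tendsto_zero_spectral_radius:
  fixes M :: "complex^'n^'n"
  assumes "spectral_radius M < 1"
  shows "mat_pow M \<longlonglongrightarrow> 0"
  using assms eigenvalue_le_spectral_radius[of _ M] by (intro mat_pow_tendsto_zero) force

text \<open>The upper half of the spectral radius formula: scaling by \<open>1 / s\<close> moves all
  eigenvalues into the open unit disc, so the scaled powers tend to zero and are bounded.\<close>

lemma norm_mat_pow_le:
  fixes M :: "complex^'n^'n"
  assumes "spectral_radius M < s"
  shows "\<exists>C>0. \<forall>k. norm (mat_pow M k) \<le> C * s ^ k"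
proof -
  have s: "s > 0"
    using spectral_radius_nonneg[of M] assms by linarith
  have "mat_pow ((1 / s) *\<^sub>R M) \<longlonglongrightarrow> 0"
  proof (rule mat_pow_tendsto_zero)
    fix c and v :: "complex^'n" assume v: "v \<noteq> 0" "((1 / s) *\<^sub>R M) *v v = c *s v"
    have "M *v v = (complex_of_real s * c) *s v"
    proof -
      have "M *v v = s *\<^sub>R (((1 / s) *\<^sub>R M) *v v)"
        using s by (simp add: scaleR_mult_vec)
      also have "\<dots> = (complex_of_real s * c) *s v"
        unfolding v(2) by (simp add: vec_eq_iff) (simp add: scaleR_conv_of_real)
      finally show ?thesis .
    qed
    then have "cmod (complex_of_real s * c) \<le> spectral_radius M"
      by (rule eigenvalue_le_spectral_radius[OF v(1)])
    then have "s * cmod c \<le> spectral_radius M"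
      using s by (simp add: norm_mult)
    with assms have "s * cmod c < s * 1"
      by linarith
    then show "cmod c < 1"
      using s by simp
  qed
  then have "Bseq (mat_pow ((1 / s) *\<^sub>R M))"
    by (intro convergent_imp_Bseq) (auto simp: convergent_def)
  then obtain C where C: "C > 0" "\<And>k. norm (mat_pow ((1 / s) *\<^sub>R M) k) \<le> C"
    by (auto elim: BseqE)
  have "norm (mat_pow M k) \<le> C * s ^ k" for k
    using C(2)[of k] s by (simp add: mat_pow_scaleR power_divide field_simps)
  with C(1) show ?thesis
    by blast
qed

section \<open>Composition of Riccati operators\<close>

text \<open>The Riccati operator without conjugation, in the form of the update in
  \<open>afpi_Y\<close>. Applying it to \<open>mconj X\<close> restores the conjugate
  equation.\<close>

fun riccati_map :: "'n coeffs \<Rightarrow> complex^'n^'n \<Rightarrow> complex^'n::finite^'n" where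
  "riccati_map (A, G, H) X = adj A ** X ** matrix_inv (mat 1 + G ** X) ** A + H"

text \<open>The push-through identity \<open>(I + G H)^-1 G = G (I + H G)^-1\<close>, where
  \<open>(I + H G)^-1\<close> is the adjoint of \<open>(I + G H)^-1\<close>; likewise with
  \<open>H\<close> on the other side.\<close>

lemma hermitian_push_through:
  assumes "hermitian G" "hermitian H" and det: "det (mat 1 + G ** H) \<noteq> 0"
  shows "hermitian (matrix_inv (mat 1 + G ** H) ** G)"
    and "hermitian (H ** matrix_inv (mat 1 + G ** H))"
proof -
  define V where "V = matrix_inv (mat 1 + G ** H)"
  have GH: "adj G = G" "adj H = H"
    using assms by (simp_all add: hermitian_def)
  have V1: "V ** (mat 1 + G ** H) = mat 1" and V2: "(mat 1 + G ** H) ** V = mat 1"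
    using matrix_inv_nonsingular[OF det] by (simp_all add: V_def)
  have aV1: "(mat 1 + H ** G) ** adj V = mat 1" and aV2: "adj V ** (mat 1 + H ** G) = mat 1"
    using arg_cong[OF V1, of adj] arg_cong[OF V2, of adj] by (simp_all add: adj_simps GH)
  have "V ** G = V ** G ** ((mat 1 + H ** G) ** adj V)"
    by (simp add: aV1)
  also have "\<dots> = V ** (mat 1 + G ** H) ** (G ** adj V)"
    by (simp add: matrix_ring)
  finally show "hermitian (V ** G)"
    by (simp add: V1 hermitian_def adj_simps GH)
  have "H ** V = adj V ** (mat 1 + H ** G) ** H ** V"
    by (simp add: aV2)
  also have "\<dots> = adj V ** H ** ((mat 1 + G ** H) ** V)"
    by (simp add: matrix_ring)
  finally show "hermitian (H ** V)"
    by (simp add: V2 hermitian_def adj_simps GH)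
qed

text \<open>With \<open>U = (I + G Z)\<^sup>-\<^sup>1 A\<close> and \<open>U\<^sub>l = (I + G\<^sub>l X)\<^sup>-\<^sup>1 A\<^sub>l\<close>, the composite coefficients satisfy
  \<open>(I + G' X)\<^sup>-\<^sup>1 A' = U\<^sub>l U\<close>; a kernel vector of \<open>I + G' X\<close> would yield one of \<open>I + G Z\<close>.\<close>

lemma afpi_step_compose:
  assumes herm: "hermitian G" "hermitian Hl"
    and step: "afpi_step (A, G, H) (Al, Gl, Hl) = (A', G', H')"
    and Z: "Z = riccati_map (Al, Gl, Hl) X"
    and det: "det (mat 1 + G ** Hl) \<noteq> 0"
    and det_l: "det (mat 1 + Gl ** X) \<noteq> 0"
    and det_Z: "det (mat 1 + G ** Z) \<noteq> 0"
  shows "det (mat 1 + G' ** X) \<noteq> 0"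
    and "riccati_map (A', G', H') X = riccati_map (A, G, H) Z"
proof -
  define V where "V = matrix_inv (mat 1 + G ** Hl)"
  define Ul where "Ul = matrix_inv (mat 1 + Gl ** X) ** Al"
  define U where "U = matrix_inv (mat 1 + G ** Z) ** A"
  have GHl: "adj G = G" "adj Hl = Hl"
    using herm by (simp_all add: hermitian_def)
  have V1: "V ** (mat 1 + G ** Hl) = mat 1" and V2: "(mat 1 + G ** Hl) ** V = mat 1"
    using matrix_inv_nonsingular[OF det] by (simp_all add: V_def)
  have aV: "adj V ** (mat 1 + Hl ** G) = mat 1"
    using arg_cong[OF V2, of adj] by (simp add: adj_simps GHl)
  have Ul: "(mat 1 + Gl ** X) ** Ul = Al" and U: "(mat 1 + G ** Z) ** U = A"
    using matrix_inv_nonsingular[OF det_l] matrix_inv_nonsingular[OF det_Z]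
    by (simp_all add: Ul_def U_def matrix_mul_assoc)
  have A': "A' = Al ** V ** A" and G': "G' = Gl + Al ** V ** G ** adj Al"
    and H': "H' = H + adj A ** Hl ** V ** A"
    using step by (auto simp: V_def Let_def)
  have ZHl: "adj Al ** X ** Ul = Z - Hl"
    by (simp add: Z Ul_def matrix_mul_assoc)
  have key: "(mat 1 + G' ** X) ** Ul = Al ** V ** (mat 1 + G ** Z)"
  proof -
    have "(mat 1 + G' ** X) ** Ul = Al + Al ** V ** G ** (adj Al ** X ** Ul)"
      using Ul by (simp add: G' matrix_ring add_ac)
    also have "\<dots> = Al ** (V ** (mat 1 + G ** Hl)) + Al ** V ** G ** (Z - Hl)"
      by (simp add: V1 ZHl)
    also have "\<dots> = Al ** V ** (mat 1 + G ** Z)"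
      by (simp add: matrix_ring)
    finally show ?thesis .
  qed
  show det': "det (mat 1 + G' ** X) \<noteq> 0"
    unfolding det_nonzero_ker
  proof safe
    fix v assume v: "(mat 1 + G' ** X) *v v = 0"
    \<comment> \<open>Chosen so that the kernel equation becomes \<open>(I + Gl X) v = Al w\<close>,
      that is \<open>v = Ul w\<close>.\<close>
    define w where "w = - ((V ** G ** adj Al ** X) *v v)"
    have "(mat 1 + Gl ** X) *v v + (Al ** V ** G ** adj Al ** X) *v v = 0"
      using v by (simp add: G' matrix_ring matrix_vector_mult_add_rdistrib add_ac)
    moreover have "(Al ** V ** G ** adj Al ** X) *v v = Al *v ((V ** G ** adj Al ** X) *v v)"
      by (simp add: matrix_vector_mul_assoc matrix_mul_assoc)
    ultimately have "(mat 1 + Gl ** X) *v v = Al *v w"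
      by (simp add: w_def eq_neg_iff_add_eq_0 vec.neg)
    then have "matrix_inv (mat 1 + Gl ** X) *v ((mat 1 + Gl ** X) *v v) = Ul *v w"
      by (simp add: Ul_def matrix_vector_mul_assoc)
    then have v_eq: "v = Ul *v w"
      by (simp only: matrix_vector_mul_assoc matrix_inv_nonsingular[OF det_l] matrix_vector_mul_lid)
    have "(mat 1 + G ** Hl) *v w = - (((mat 1 + G ** Hl) ** V ** (G ** adj Al ** X)) *v v)"
      by (simp add: w_def vec.neg matrix_vector_mul_assoc matrix_mul_assoc)
    also have "\<dots> = - ((G ** (adj Al ** X ** Ul)) *v w)"
      by (simp add: V2 v_eq matrix_vector_mul_assoc matrix_mul_assoc)
    also have "\<dots> = (G ** Hl) *v w - (G ** Z) *v w"
      by (simp add: ZHl matrix_ring matrix_vector_mult_diff_rdistrib)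
    finally have "(mat 1 + G ** Z) *v w = 0"
      by (simp add: matrix_vector_mult_add_rdistrib eq_neg_iff_add_eq_0)
    then have "w = 0"
      using det_Z det_nonzero_ker by blast
    then show "v = 0"
      by (simp add: v_eq)
  qed
  have S: "matrix_inv (mat 1 + G' ** X) ** A' = Ul ** U"
  proof -
    have "(mat 1 + G' ** X) ** (Ul ** U) = A'"
      using key U by (metis A' matrix_mul_assoc)
    then show ?thesis
      using matrix_inv_nonsingular(2)[OF det'] by (metis matrix_mul_assoc matrix_mul_lid)
  qed
  \<comment> \<open>Aim: \<open>Hl V A + adj V (Z - Hl) U = Z U\<close>. It is first proved
    multiplied by \<open>I + Hl G\<close>, and \<open>adj V\<close> is a left inverse of that
    factor.\<close>
  have "(mat 1 + Hl ** G) ** (Hl ** V ** A) = Hl ** ((mat 1 + G ** Hl) ** V) ** A"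
    by (simp add: matrix_ring)
  then have "(mat 1 + Hl ** G) ** (Hl ** V ** A) + (Z - Hl) ** U = Hl ** A + (Z - Hl) ** U"
    by (simp add: V2)
  also have "\<dots> = Hl ** ((mat 1 + G ** Z) ** U) + (Z - Hl) ** U"
    by (simp add: U)
  also have "\<dots> = (mat 1 + Hl ** G) ** (Z ** U)"
    by (simp add: matrix_ring)
  finally have "adj V ** (mat 1 + Hl ** G) ** (Hl ** V ** A) + adj V ** (Z - Hl) ** U
      = adj V ** (mat 1 + Hl ** G) ** (Z ** U)"
    by (metis matrix_add_ldistrib matrix_mul_assoc)
  then have ZU: "Hl ** V ** A + adj V ** (Z - Hl) ** U = Z ** U"
    by (simp only: aV matrix_mul_lid)
  have "riccati_map (A', G', H') X = adj A' ** X ** (matrix_inv (mat 1 + G' ** X) ** A') + H'"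
    by (simp add: matrix_mul_assoc)
  also have "\<dots> = adj A ** adj V ** (adj Al ** X ** Ul) ** U + adj A ** Hl ** V ** A + H"
    unfolding S by (simp add: A' H' adj_simps matrix_mul_assoc)
  also have "\<dots> = adj A ** (Hl ** V ** A + adj V ** (Z - Hl) ** U) + H"
    unfolding ZHl by (simp add: matrix_ring)
  also have "\<dots> = riccati_map (A, G, H) Z"
    unfolding ZU by (simp add: U_def matrix_mul_assoc)
  finally show "riccati_map (A', G', H') X = riccati_map (A, G, H) Z" .
qed

text \<open>Besides the values on \<open>D\<close> it records Hermitian coefficients and
  nonsingularity, which is what the composition of two triples needs and reproduces.\<close>

definition realizes ::
  "(complex^'n^'n) set \<Rightarrow> 'n::finite coeffs \<Rightarrow> (complex^'n^'n \<Rightarrow> complex^'n^'n) \<Rightarrow> bool" where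
  "realizes D t f \<longleftrightarrow> (case t of (A, G, H) \<Rightarrow> hermitian G \<and> hermitian H \<and>
     (\<forall>X\<in>D. det (mat 1 + G ** X) \<noteq> 0 \<and> riccati_map t X = f X))"

text \<open>The outer triple acts after the inner one. The separate determinant hypothesis concerns
  \<open>Hl\<close>, which need not lie in the set where the outer triple is controlled.\<close>

lemma realizes_afpi_step:
  assumes f: "realizes E (A, G, H) f" and g: "realizes D (Al, Gl, Hl) g" and "g ` D \<subseteq> E"
    and det: "det (mat 1 + G ** Hl) \<noteq> 0"
  shows "realizes D (afpi_step (A, G, H) (Al, Gl, Hl)) (f \<circ> g)"
proof -
  obtain A' G' H' where step: "afpi_step (A, G, H) (Al, Gl, Hl) = (A', G', H')"
    by (cases "afpi_step (A, G, H) (Al, Gl, Hl)")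
  define V where "V = matrix_inv (mat 1 + G ** Hl)"
  have h: "hermitian G" "hermitian H" "hermitian Gl" "hermitian Hl"
    using f g by (simp_all add: realizes_def)
  have "G' = Gl + adj (adj Al) ** (V ** G) ** adj Al" "H' = H + adj A ** (Hl ** V) ** A"
    using step by (auto simp: V_def Let_def adj_adj matrix_mul_assoc)
  then have "hermitian G'" "hermitian H'"
    using hermitian_push_through[OF h(1,4) det] h
    by (simp_all add: V_def hermitian_add hermitian_congruence)
  moreover have "det (mat 1 + G' ** X) \<noteq> 0 \<and> riccati_map (A', G', H') X = f (g X)" if "X \<in> D" for X
  proof -
    have "riccati_map (Al, Gl, Hl) X = g X" "det (mat 1 + Gl ** X) \<noteq> 0" "g X \<in> E"
      using g that assms(3) by (auto simp: realizes_def)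
    moreover from this have "det (mat 1 + G ** g X) \<noteq> 0" "riccati_map (A, G, H) (g X) = f (g X)"
      using f by (auto simp: realizes_def)
    ultimately show ?thesis
      using afpi_step_compose[OF h(1,4) step _ det] by metis
  qed
  ultimately show ?thesis
    unfolding step by (simp add: realizes_def)
qed

text \<open>The inner triple with index 1 is the outer triple itself, so index \<open>l\<close>
  stands for exactly \<open>l\<close> applications.\<close>

lemma realizes_afpi_inner:
  assumes f: "realizes D (A, G, H) f" and "f ` D \<subseteq> D"
    and det: "\<forall>l\<in>{1..r - 1}. case afpi_inner (A, G, H) l of (Al, Gl, Hl) \<Rightarrow> det (mat 1 + G ** Hl) \<noteq> 0"
    and "1 \<le> l" "l \<le> r"
  shows "realizes D (afpi_inner (A, G, H) l) (f ^^ l)"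
  using assms(4,5)
proof (induction l rule: dec_induct)
  case base
  then show ?case
    using f by (simp add: afpi_inner_def)
next
  case (step l)
  obtain Al Gl Hl where l: "afpi_inner (A, G, H) l = (Al, Gl, Hl)"
    by (cases "afpi_inner (A, G, H) l")
  have "afpi_inner (A, G, H) (Suc l) = afpi_step (A, G, H) (afpi_inner (A, G, H) l)"
    using step.hyps by (cases l) (simp_all add: afpi_inner_def)
  moreover have "(f ^^ l) ` D \<subseteq> D"
    using assms(2) by (induction l) auto
  moreover have "det (mat 1 + G ** Hl) \<noteq> 0"
    using det[THEN bspec, of l] step l by auto
  ultimately show ?case
    using realizes_afpi_step[OF f, of D Al Gl Hl "f ^^ l"] step l
    by (simp add: comp_def del: afpi_step.simps)
qed

text \<open>Each outer update passes to the \<open>r\<close>-th iterate of the current operator, so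
  the exponents multiply.\<close>

lemma realizes_afpi_coeffs:
  assumes f: "realizes D t f" and fD: "f ` D \<subseteq> D" and nb: "afpi_no_breakdown r t" and "1 \<le> r"
  shows "realizes D (afpi_coeffs r t k) (f ^^ (r ^ k))"
proof (induction k)
  case 0
  then show ?case
    using f by simp
next
  case (Suc k)
  obtain A G H where k: "afpi_coeffs r t k = (A, G, H)"
    by (cases "afpi_coeffs r t k")
  have "(f ^^ n) ` D \<subseteq> D" for n
    using fD by (induction n) auto
  moreover have "\<forall>l\<in>{1..r - 1}. case afpi_inner (A, G, H) l of (Al, Gl, Hl) \<Rightarrow> det (mat 1 + G ** Hl) \<noteq> 0"
    using nb[unfolded afpi_no_breakdown_def, THEN spec, of k] by (simp add: k)
  ultimately have "realizes D (afpi_inner (A, G, H) r) ((f ^^ (r ^ k)) ^^ r)"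
    using Suc \<open>1 \<le> r\<close> unfolding k by (intro realizes_afpi_inner) auto
  then show ?case
    by (simp add: k funpow_mult mult.commute)
qed

text \<open>Restricted to successors: \<open>afpi_Y\<close> starts at \<open>X\<close> itself, while
  the triple with index 0 already realizes one application of \<open>f\<close>.\<close>

lemma afpi_Y_Suc_eq_funpow:
  assumes "realizes D t f" "f ` D \<subseteq> D" "afpi_no_breakdown r t" "1 \<le> r" "X \<in> D"
  shows "afpi_Y r t X (Suc k) = (f ^^ (r ^ Suc k)) X"
proof -
  obtain A G H where k: "afpi_coeffs r t (Suc k) = (A, G, H)"
    by (cases "afpi_coeffs r t (Suc k)")
  have "realizes D (A, G, H) (f ^^ (r ^ Suc k))"
    using realizes_afpi_coeffs[OF assms(1-4), of "Suc k"] unfolding k .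
  then have "riccati_map (A, G, H) X = (f ^^ (r ^ Suc k)) X"
    using \<open>X \<in> D\<close> unfolding realizes_def by blast
  moreover have "afpi_Y r t X (Suc k) = riccati_map (A, G, H) X"
    using k by simp
  ultimately show ?thesis
    by simp
qed

section \<open>The transformed coefficients\<close>

lemma sum_UNIV_Plus:
  "(\<Sum>x\<in>UNIV. f x) = (\<Sum>a\<in>UNIV. f (Inl a)) + (\<Sum>b\<in>UNIV. f (Inr b))"
  for f :: "'a::finite + 'b::finite \<Rightarrow> 'c::comm_monoid_add"
  unfolding UNIV_Plus_UNIV[symmetric] by (subst sum.Plus) simp_all

lemma block_diag_inverse:
  assumes "det M \<noteq> 0" "det L \<noteq> 0"
  shows "matrix_inv (block_diag M L) = block_diag (matrix_inv M) (matrix_inv L)"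
proof (rule right_inverse_unique)
  have "(block_diag M L ** block_diag (matrix_inv M) (matrix_inv L)) $ i $ j
      = block_diag (M ** matrix_inv M) (L ** matrix_inv L) $ i $ j" for i j
    by (cases i; cases j) (simp_all add: block_diag_def matrix_matrix_mult_def sum_UNIV_Plus)
  moreover have "block_diag (mat 1) (mat 1) $ i $ j = mat 1 $ i $ j" for i :: "'a + 'b" and j
    by (cases i; cases j) (simp_all add: block_diag_def mat_def)
  ultimately show "block_diag M L ** block_diag (matrix_inv M) (matrix_inv L) = mat 1"
    by (simp add: vec_eq_iff matrix_inv_nonsingular assms)
qed

lemma B_hat_block_diag:
  "B_hat A B ** block_diag M L ** adj (B_hat A B)
    = mconj B ** M ** adj (mconj B) + mconj A ** B ** L ** adj (mconj A ** B)"
proof -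
  have "(B_hat A B ** block_diag M L) $ i $ Inl a = (mconj B ** M) $ i $ a" for i a
    by (simp add: B_hat_def block_diag_def matrix_matrix_mult_def sum_UNIV_Plus)
  moreover have "(B_hat A B ** block_diag M L) $ i $ Inr b = (mconj A ** B ** L) $ i $ b" for i b
    by (simp add: B_hat_def block_diag_def matrix_matrix_mult_def sum_UNIV_Plus)
  moreover have "adj (B_hat A B) $ Inl a $ j = adj (mconj B) $ a $ j"
    "adj (B_hat A B) $ Inr a $ j = adj (mconj A ** B) $ a $ j" for a j
    by (simp_all add: B_hat_def adj_nth)
  ultimately show ?thesis
    unfolding vec_eq_iff vector_add_component
      matrix_matrix_mult_def[of "B_hat A B ** block_diag M L"]
      matrix_matrix_mult_def[of "mconj B ** M"] matrix_matrix_mult_def[of "mconj A ** B ** L"]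
    by (simp add: sum_UNIV_Plus)
qed

text \<open>With \<open>S = R + B^H K B\<close> and \<open>Q = B S^-1 B^H\<close>, substituting
  \<open>B^H K B = S - R\<close> gives \<open>G K Q = G - Q\<close>. Hence \<open>I - Q K\<close> is
  a right inverse of \<open>I + G K\<close>, and \<open>(I + G K) Q = G\<close>.\<close>

lemma woodbury:
  assumes "det R \<noteq> 0" and det: "det (R + adj B ** K ** B) \<noteq> 0"
  shows "det (mat 1 + G_of B R ** K) \<noteq> 0"
    and "matrix_inv (mat 1 + G_of B R ** K) = mat 1 - B ** matrix_inv (R + adj B ** K ** B) ** adj B ** K"
    and "matrix_inv (mat 1 + G_of B R ** K) ** G_of B R = B ** matrix_inv (R + adj B ** K ** B) ** adj B"
proof -
  define S where "S = R + adj B ** K ** B"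
  define Q where "Q = B ** matrix_inv S ** adj B"
  have "G_of B R ** K ** Q = B ** matrix_inv R ** (S - R) ** matrix_inv S ** adj B"
    by (simp add: G_of_def Q_def S_def matrix_mul_assoc)
  also have "\<dots> = B ** matrix_inv R ** (S ** matrix_inv S) ** adj B
      - B ** (matrix_inv R ** R) ** matrix_inv S ** adj B"
    by (simp add: matrix_ring)
  also have "\<dots> = G_of B R - Q"
    using matrix_inv_nonsingular[OF assms(1)] matrix_inv_nonsingular[OF det]
    by (simp add: S_def G_of_def Q_def)
  finally have GKQ: "G_of B R ** K ** Q = G_of B R - Q" .
  then have "(mat 1 + G_of B R ** K) ** (mat 1 - Q ** K) = mat 1"
    by (simp add: matrix_ring)
  note inv = right_inverse_det_nonzero[OF this] right_inverse_unique[OF this]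
  show "det (mat 1 + G_of B R ** K) \<noteq> 0"
    and "matrix_inv (mat 1 + G_of B R ** K) = mat 1 - B ** matrix_inv S ** adj B ** K"
    using inv by (simp_all add: Q_def)
  have "(mat 1 + G_of B R ** K) ** Q = G_of B R"
    using GKQ by (simp add: matrix_add_rdistrib)
  then show "matrix_inv (mat 1 + G_of B R ** K) ** G_of B R = B ** matrix_inv S ** adj B"
    using matrix_inv_nonsingular(2)[OF inv(1)] by (metis Q_def matrix_mul_assoc matrix_mul_lid)
qed

lemma hermitian_G_of: "hermitian R \<Longrightarrow> det R \<noteq> 0 \<Longrightarrow> hermitian (G_of B R)"
  using hermitian_congruence[OF hermitian_matrix_inv[of R], of "adj B"] by (simp add: G_of_def adj_adj)

lemma ric_eq_riccati_map:
  assumes "det R \<noteq> 0" "det (R_at B R X) \<noteq> 0"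
  shows "ric A B R H X = riccati_map (A, G_of B R, H) (mconj X)"
proof -
  have "matrix_inv (mat 1 + G_of B R ** mconj X)
      = mat 1 - B ** matrix_inv (R_at B R X) ** adj B ** mconj X"
    using woodbury(2)[OF assms(1) assms(2)[unfolded R_at_def]] by (simp only: R_at_def)
  then show ?thesis
    by (simp only: riccati_map.simps ric_def) (simp add: matrix_ring)
qed

lemma mconj_riccati_map:
  assumes "det (mat 1 + G ** X) \<noteq> 0"
  shows "mconj (riccati_map (A, G, H) X) = riccati_map (mconj A, mconj G, mconj H) (mconj X)"
  using matrix_inv_mconj[OF assms] by (simp only: riccati_map.simps mconj_simps adj_mconj)

text \<open>The transformed coefficients are a single composition step whose inner triple is the
  entrywise conjugate of the outer one.\<close>

lemma afpi_step_conjugate: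
  assumes R: "det R \<noteq> 0" and RH: "det (R_at B R H) \<noteq> 0"
  shows "afpi_step (A, G_of B R, H) (mconj A, mconj (G_of B R), mconj H)
    = (A_hat A B R H, G_hat A B R H, H_hat A B R H)"
proof -
  note W = woodbury[OF R RH[unfolded R_at_def]]
  have "mconj (G_of B R) = mconj B ** matrix_inv (mconj R) ** adj (mconj B)"
    by (simp add: G_of_def mconj_mult matrix_inv_mconj[OF R] adj_mconj)
  then have "G_hat A B R H = mconj (G_of B R)
      + mconj A ** (B ** matrix_inv (R + adj B ** mconj H ** B) ** adj B) ** adj (mconj A)"
    by (simp add: G_hat_def R_hat_def block_diag_inverse det_mconj_nonzero R RH B_hat_block_diag
        adj_mult matrix_mul_assoc flip: R_at_def)
  moreover have "A_hat A B R H = mconj A ** matrix_inv (mat 1 + G_of B R ** mconj H) ** A"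
    unfolding W(2) by (simp add: A_hat_def R_at_def matrix_ring)
  ultimately show ?thesis
    unfolding W(3)[symmetric] by (simp add: Let_def H_hat_def matrix_mul_assoc)
qed

section \<open>Monotonicity of the Riccati operator\<close>

text \<open>One step under an arbitrary gain \<open>F\<close>. For fixed \<open>F\<close> it is
  real-affine in \<open>X\<close> and contains no inverse, so differences and limits are
  immediate.\<close>

definition closed_loop ::
  "complex^'n^'n \<Rightarrow> complex^'m^'n \<Rightarrow> complex^'m^'m \<Rightarrow> complex^'n^'n \<Rightarrow> complex^'n^'m \<Rightarrow> complex^'n^'n \<Rightarrow> complex^'n^'n" where
  "closed_loop A B R H F X = adj (A - B ** F) ** mconj X ** (A - B ** F) + adj F ** R ** F + H"

lemma closed_loop_diff:
  "closed_loop A B R H F X - closed_loop A B R H F Y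
    = adj (A - B ** F) ** mconj (X - Y) ** (A - B ** F)"
  by (simp add: closed_loop_def mconj_diff matrix_diff_ldistrib matrix_diff_rdistrib)

lemma closed_loop_mono: "X \<succeq> Y \<Longrightarrow> closed_loop A B R H F X \<succeq> closed_loop A B R H F Y"
  unfolding loewner_ge_def closed_loop_diff by (intro psd_congruence psd_mconj)

lemma hermitian_R_at: "hermitian R \<Longrightarrow> hermitian X \<Longrightarrow> hermitian (R_at B R X)"
  by (simp add: R_at_def hermitian_add hermitian_congruence hermitian_mconj)

text \<open>With \<open>S = R_at B R X\<close> and \<open>K = adj B ** mconj X ** A\<close> the
  optimal gain solves \<open>S f = K\<close>; this makes the cross terms of the square equal to the
  terms linear in \<open>F\<close>.\<close>

lemma closed_loop_complete_square:
  assumes R: "hermitian R" and X: "hermitian X" and det: "det (R_at B R X) \<noteq> 0"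
  shows "closed_loop A B R H F X = ric A B R H X
    + adj (F - F_at A B R X) ** R_at B R X ** (F - F_at A B R X)"
proof -
  define S where "S = R_at B R X"
  define f where "f = F_at A B R X"
  define K where "K = adj B ** mconj X ** A"
  have aS: "adj S = S" and aX: "adj (mconj X) = mconj X"
    using hermitian_R_at[OF R X] hermitian_mconj[OF X] by (simp_all add: S_def hermitian_def)
  have f: "f = matrix_inv S ** K"
    by (simp add: f_def F_at_def S_def K_def matrix_mul_assoc)
  have Sf: "S ** f = K"
    using matrix_inv_nonsingular[OF det] by (simp add: f S_def matrix_mul_assoc)
  have aK: "adj K = adj A ** mconj X ** B"
    by (simp only: K_def adj_mult aX adj_adj matrix_mul_assoc)
  have fS: "adj f ** S = adj K"
    using arg_cong[OF Sf, of adj] by (simp only: adj_mult aS)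
  have ric: "ric A B R H X = adj A ** mconj X ** A - adj K ** f + H"
    unfolding aK f by (simp add: ric_def K_def S_def matrix_mul_assoc)
  have "adj (F - f) ** S ** (F - f) = adj F ** S ** F - adj F ** (S ** f) - adj f ** S ** F + adj f ** S ** f"
    by (simp add: adj_diff matrix_ring)
  also have "\<dots> = adj F ** S ** F - adj F ** K - adj K ** F + adj K ** f"
    by (simp only: fS Sf)
  finally have sq: "adj (F - f) ** S ** (F - f) = adj F ** S ** F - adj F ** K - adj K ** F + adj K ** f" .
  have "closed_loop A B R H F X = adj A ** mconj X ** A - adj K ** F - adj F ** K + adj F ** S ** F + H"
    unfolding aK by (simp add: closed_loop_def adj_diff adj_mult K_def S_def R_at_def matrix_ring)
  also have "\<dots> = ric A B R H X + adj (F - f) ** S ** (F - f)"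
    unfolding sq ric by simp
  finally show ?thesis
    by (simp add: S_def f_def)
qed

lemma closed_loop_F_at:
  assumes "hermitian R" "hermitian X" "det (R_at B R X) \<noteq> 0"
  shows "closed_loop A B R H (F_at A B R X) X = ric A B R H X"
  by (simp add: closed_loop_complete_square[OF assms])

lemma closed_loop_ge_ric:
  assumes "hermitian R" "hermitian X" "posdef (R_at B R X)"
  shows "closed_loop A B R H F X \<succeq> ric A B R H X"
  using closed_loop_complete_square[OF assms(1,2) posdef_det_nonzero[OF assms(3)], of A H F]
  by (simp add: loewner_ge_def psd_congruence posdef_psd assms(3))

lemma hermitian_ge: "X \<succeq> Y \<Longrightarrow> hermitian Y \<Longrightarrow> hermitian X"
  unfolding loewner_ge_def using hermitian_add[of "X - Y" Y] psd_hermitian by fastforce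

lemma posdef_R_at_ge:
  assumes "X \<succeq> Y" "posdef (R_at B R Y)"
  shows "posdef (R_at B R X)"
proof -
  have "R_at B R X = R_at B R Y + adj B ** mconj (X - Y) ** B"
    by (simp add: R_at_def mconj_diff matrix_diff_ldistrib matrix_diff_rdistrib)
  then show ?thesis
    using assms by (simp add: loewner_ge_def posdef_add_psd psd_congruence psd_mconj)
qed

text \<open>Use the optimal gain of the larger argument for both: it is exact at \<open>X\<close>,
  the closed loop is monotone, and at \<open>Y\<close> it can only do worse than the optimal
  gain.\<close>

lemma ric_mono:
  assumes R: "hermitian R" and Y: "hermitian Y" "posdef (R_at B R Y)" and XY: "X \<succeq> Y"
  shows "ric A B R H X \<succeq> ric A B R H Y"
proof -
  have X: "hermitian X" "posdef (R_at B R X)"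
    using hermitian_ge posdef_R_at_ge XY Y by blast+
  then have "ric A B R H X = closed_loop A B R H (F_at A B R X) X"
    by (simp add: closed_loop_F_at R posdef_det_nonzero)
  moreover have "closed_loop A B R H (F_at A B R X) X \<succeq> closed_loop A B R H (F_at A B R X) Y"
    by (rule closed_loop_mono[OF XY])
  moreover have "closed_loop A B R H (F_at A B R X) Y \<succeq> ric A B R H Y"
    by (rule closed_loop_ge_ric[OF R Y])
  ultimately show ?thesis
    by (metis loewner_trans)
qed

section \<open>Continuity and norm bounds for matrix operations\<close>

lemma bounded_bilinear_matrix_mult:
  "bounded_bilinear ((**) :: complex^'n^'m \<Rightarrow> complex^'p^'n \<Rightarrow> complex^'p^'m)"
  by (rule bilinear_conv_bounded_bilinear[THEN iffD1])
    (simp add: bilinear_def linear_iff matrix_add_ldistrib matrix_add_rdistrib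
      scaleR_mult_left scaleR_mult_right)

lemma tendsto_mconj: "(f \<longlongrightarrow> L) F \<Longrightarrow> ((\<lambda>x. mconj (f x)) \<longlongrightarrow> mconj L) F"
  unfolding map_matrix_def by (intro tendsto_intros)

lemma tendsto_adj: "(f \<longlongrightarrow> L) F \<Longrightarrow> ((\<lambda>x. adj (f x)) \<longlongrightarrow> adj L) F"
  unfolding adj_def transpose_def map_matrix_def vec_lambda_beta by (intro tendsto_intros)

lemma closed_loop_tendsto:
  "(f \<longlongrightarrow> L) G \<Longrightarrow> ((\<lambda>x. closed_loop A B R H F (f x)) \<longlongrightarrow> closed_loop A B R H F L) G"
  unfolding closed_loop_def
  by (intro tendsto_intros bounded_bilinear.tendsto[OF bounded_bilinear_matrix_mult] tendsto_mconj)

lemma norm_congruence_le: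
  fixes D :: "complex^'n^'n"
  shows "\<exists>C>0. \<forall>P :: complex^'n^'n. norm (adj P ** D ** P) \<le> C * (norm P)\<^sup>2"
proof -
  obtain K where K: "K > 0" "\<And>(P :: complex^'n^'n) (Q :: complex^'n^'n). norm (P ** Q) \<le> norm P * norm Q * K"
    using bounded_bilinear.pos_bounded[OF bounded_bilinear_matrix_mult] by blast
  define c where "c = real CARD('n) * real CARD('n)"
  have "c > 0"
    by (simp add: c_def)
  have adj: "norm (adj P) \<le> c * norm P" for P :: "complex^'n^'n"
    unfolding c_def
    by (rule norm_matrix_le_entries)
      (simp add: adj_nth order_trans[OF Finite_Cartesian_Product.norm_nth_le Finite_Cartesian_Product.norm_nth_le])
  show ?thesis
  proof (intro exI conjI allI)
    \<comment> \<open>The summand 1 keeps the constant positive when \<open>D = 0\<close>.\<close>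
    show "c * norm D * K\<^sup>2 + 1 > 0"
      using \<open>c > 0\<close> K(1) by (simp add: add_nonneg_pos)
    fix P :: "complex^'n^'n"
    have "norm (adj P ** D ** P) \<le> norm (adj P ** D) * norm P * K"
      by (rule K(2))
    also have "\<dots> \<le> (norm (adj P) * norm D * K) * norm P * K"
      using K by (intro mult_right_mono) auto
    also have "\<dots> \<le> ((c * norm P) * norm D * K) * norm P * K"
      using K(1) adj[of P] by (intro mult_right_mono) auto
    also have "\<dots> = c * norm D * K\<^sup>2 * (norm P)\<^sup>2"
      by (simp add: power2_eq_square)
    also have "\<dots> \<le> (c * norm D * K\<^sup>2 + 1) * (norm P)\<^sup>2"
      by (intro mult_right_mono) auto
    finally show "norm (adj P ** D ** P) \<le> (c * norm D * K\<^sup>2 + 1) * (norm P)\<^sup>2" .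
  qed
qed

section \<open>The conjugate Stein inequality\<close>

lemma congruence_mono: "X \<succeq> Y \<Longrightarrow> adj T ** X ** T \<succeq> adj T ** Y ** T"
  unfolding loewner_ge_def using psd_congruence[of "X - Y" T]
  by (simp add: matrix_diff_ldistrib matrix_diff_rdistrib)

lemma mconj_mono: "X \<succeq> Y \<Longrightarrow> mconj X \<succeq> mconj Y"
  unfolding loewner_ge_def using psd_mconj[of "X - Y"] by (simp add: mconj_diff)

text \<open>Two steps of the conjugate Stein inequality are one step of an ordinary one, with
  coefficient \<open>mconj T ** T\<close>.\<close>

lemma conjugate_stein_psd:
  assumes rho: "spectral_radius (mconj T ** T) < 1" and D: "D \<succeq> adj T ** mconj D ** T"
  shows "psd D"
proof -
  define S where "S = mconj T ** T"
  have "mconj D \<succeq> adj (mconj T) ** D ** mconj T"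
    using mconj_mono[OF D] by (simp add: mconj_simps adj_mconj)
  from loewner_trans[OF D congruence_mono[OF this]]
  have D2: "D \<succeq> adj S ** D ** S"
    by (simp add: S_def adj_mult matrix_mul_assoc)
  have pow: "D \<succeq> adj (mat_pow S k) ** D ** mat_pow S k" for k
  proof (induction k)
    case (Suc k)
    then show ?case
      using congruence_mono[OF D2, of "mat_pow S k"]
      by (auto intro: loewner_trans simp: adj_mult matrix_mul_assoc)
  qed (simp add: adj_mat_1 loewner_refl)
  have lim: "mat_pow S \<longlonglongrightarrow> 0"
    using mat_pow_tendsto_zero_spectral_radius rho by (simp add: S_def)
  have "(\<lambda>k. adj (mat_pow S k) ** D ** mat_pow S k) \<longlonglongrightarrow> adj 0 ** D ** 0"
    by (intro bounded_bilinear.tendsto[OF bounded_bilinear_matrix_mult] tendsto_adj tendsto_const lim)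
  then have "D \<succeq> adj 0 ** D ** 0"
    by (rule loewner_tendsto[OF tendsto_const]) (simp_all add: pow)
  then show ?thesis
    by (simp add: loewner_ge_def)
qed

section \<open>The fixed-point iteration\<close>

locale cdare_max =
  fixes A H X_M :: "complex^'n^'n" and B :: "complex^'m^'n" and R :: "complex^'m^'m"
  assumes R: "hermitian R" and max: "cdare_maximal A B R H X_M"
begin

lemma X_M: "hermitian X_M" "ric A B R H X_M = X_M" "posdef (R_at B R X_M)"
  using max by (auto simp: cdare_maximal_def cdare_solution_def)

lemma ge_X_M: "X \<succeq> X_M \<Longrightarrow> hermitian X" "X \<succeq> X_M \<Longrightarrow> posdef (R_at B R X)"
  using hermitian_ge posdef_R_at_ge X_M by blast+

text \<open>The matrices above the fixed point \<open>X_M\<close> form an invariant region; since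
  \<open>R_at\<close> is positive definite there, the iteration never meets a singular
  inverse.\<close>

lemma ric_ge_X_M: "X \<succeq> X_M \<Longrightarrow> ric A B R H X \<succeq> X_M"
  using ric_mono[OF R X_M(1,3), of X A H] X_M(2) by simp

text \<open>The gain of the stabilizing \<open>W\<close> satisfies the closed-loop inequality at
  \<open>X0\<close> by assumption, and the opposite one at \<open>X_M\<close> because it is
  suboptimal there. Subtracting gives a conjugate Stein inequality for \<open>X0 - X_M\<close>.
  Being above \<open>X_M\<close> then allows the comparison with the optimal gain at
  \<open>X0\<close>.\<close>

lemma set_S_ge_imp:
  assumes "X0 \<in> set_S_ge A B R H"
  shows "X0 \<succeq> X_M" "X0 \<succeq> ric A B R H X0"
proof -
  obtain W where W: "W \<in> set_T A B R" and X0: "hermitian X0"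
    "X0 - adj (T_at A B R W) ** mconj X0 ** T_at A B R W \<succeq> H + adj (F_at A B R W) ** R ** F_at A B R W"
    using assms by (auto simp: set_S_ge_def)
  define T where "T = T_at A B R W"
  define F where "F = F_at A B R W"
  have T: "T = A - B ** F"
    by (simp add: T_def F_def T_at_def)
  have X0': "X0 \<succeq> closed_loop A B R H F X0"
    using X0(2) by (simp add: loewner_ge_def closed_loop_def T_at_def F_def algebra_simps)
  have "closed_loop A B R H F X_M \<succeq> X_M"
    using closed_loop_ge_ric[OF R X_M(1,3), of A H F] X_M(2) by simp
  then have "psd ((X0 - closed_loop A B R H F X0) + (closed_loop A B R H F X_M - X_M))"
    using X0' by (intro psd_add) (simp_all add: loewner_ge_def)
  also have "(X0 - closed_loop A B R H F X0) + (closed_loop A B R H F X_M - X_M)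
      = (X0 - X_M) - (closed_loop A B R H F X0 - closed_loop A B R H F X_M)"
    by simp
  finally have "X0 - X_M \<succeq> adj T ** mconj (X0 - X_M) ** T"
    unfolding closed_loop_diff by (simp add: loewner_ge_def T)
  moreover have "spectral_radius (mconj T ** T) < 1"
    using W by (simp add: set_T_def That_at_def T_def)
  ultimately show ge: "X0 \<succeq> X_M"
    unfolding loewner_ge_def[of X0] by (rule conjugate_stein_psd[rotated])
  show "X0 \<succeq> ric A B R H X0"
    using X0' closed_loop_ge_ric[OF R ge_X_M[OF ge], of A H F] by (rule loewner_trans)
qed

lemma funpow_ric_ge_X_M: "X \<succeq> X_M \<Longrightarrow> (ric A B R H ^^ k) X \<succeq> X_M"
  by (induction k) (auto intro: ric_ge_X_M)

lemma funpow_ric_decreasing: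
  assumes "X \<succeq> X_M" "X \<succeq> ric A B R H X" "j \<le> k"
  shows "(ric A B R H ^^ j) X \<succeq> (ric A B R H ^^ k) X"
proof -
  have "(ric A B R H ^^ i) X \<succeq> (ric A B R H ^^ Suc i) X" for i
  proof (induction i)
    case (Suc i)
    let ?Y = "(ric A B R H ^^ Suc i) X"
    have "?Y \<succeq> X_M"
      by (rule funpow_ric_ge_X_M[OF assms(1)])
    then show ?case
      using ric_mono[OF R ge_X_M, of ?Y "(ric A B R H ^^ i) X" A H] Suc by simp
  qed (use assms(2) in simp)
  from this assms(3) show ?thesis
    by (rule loewner_decreasing)
qed

text \<open>The limit \<open>L\<close> is a fixed point by two inequalities. Monotonicity applied to
  iterates above \<open>L\<close> gives \<open>L \<succeq> ric A B R H L\<close>; the closed loop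
  with the gain of \<open>L\<close> gives the converse. Maximality then identifies
  \<open>L\<close>.\<close>

lemma funpow_ric_tendsto:
  assumes "X \<succeq> X_M" "X \<succeq> ric A B R H X"
  shows "(\<lambda>k. (ric A B R H ^^ k) X) \<longlonglongrightarrow> X_M"
proof -
  let ?X = "\<lambda>k. (ric A B R H ^^ k) X"
  have dec: "?X j \<succeq> ?X k" if "j \<le> k" for j k
    by (rule funpow_ric_decreasing[OF assms that])
  have "convergent ?X"
    by (rule loewner_decreasing_convergent[OF dec funpow_ric_ge_X_M[OF assms(1)]]) simp
  then obtain L where L: "?X \<longlonglongrightarrow> L"
    by (auto simp: convergent_def)
  have L': "(\<lambda>k. ?X (Suc k)) \<longlonglongrightarrow> L"
    using L by (rule LIMSEQ_Suc)
  have "L \<succeq> X_M"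
    by (rule loewner_tendsto[OF L tendsto_const]) (simp_all add: funpow_ric_ge_X_M assms(1))
  note L_ge = ge_X_M[OF this]
  have X_L: "?X k \<succeq> L" for k
  proof (rule loewner_tendsto[OF tendsto_const L])
    show "\<forall>\<^sub>F j in sequentially. ?X k \<succeq> ?X j"
      using eventually_ge_at_top[of k] by eventually_elim (rule dec)
  qed simp
  have "L \<succeq> ric A B R H L"
    by (rule loewner_tendsto[OF L' tendsto_const]) (simp_all add: ric_mono[OF R L_ge X_L])
  moreover have "ric A B R H L \<succeq> L"
  proof -
    \<comment> \<open>The gain stays fixed along the sequence, so the step is continuous in the
      iterate, and at \<open>L\<close> it coincides with \<open>ric\<close>.\<close>
    let ?F = "F_at A B R L"
    have "closed_loop A B R H ?F L \<succeq> L"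
    proof (rule loewner_tendsto[OF closed_loop_tendsto[OF L] L'])
      show "\<forall>\<^sub>F k in sequentially. closed_loop A B R H ?F (?X k) \<succeq> ?X (Suc k)"
        using closed_loop_ge_ric[OF R ge_X_M[OF funpow_ric_ge_X_M[OF assms(1)]]] by simp
    qed simp
    then show ?thesis
      by (simp add: closed_loop_F_at R L_ge posdef_det_nonzero)
  qed
  ultimately have "cdare_solution A B R H L"
    using loewner_antisym L_ge by (simp add: cdare_solution_def)
  then have "X_M \<succeq> L"
    using max by (simp add: cdare_maximal_def)
  with \<open>L \<succeq> X_M\<close> have "L = X_M"
    using loewner_antisym by blast
  with L show ?thesis
    by simp
qed

lemma funpow_ric_error:
  assumes X: "X \<succeq> X_M"
  defines "S \<equiv> That_at A B R X_M"
  shows "adj (mat_pow S j) ** (X - X_M) ** mat_pow S j \<succeq> (ric A B R H ^^ (2 * j)) X - X_M"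
proof (induction j)
  case 0
  then show ?case
    by (simp add: adj_mat_1 loewner_refl)
next
  case (Suc j)
  define T where "T = T_at A B R X_M"
  have step: "adj T ** mconj (Y - X_M) ** T \<succeq> ric A B R H Y - X_M" if "Y \<succeq> X_M" for Y
  proof -
    let ?F = "F_at A B R X_M"
    have "closed_loop A B R H ?F X_M = X_M"
      using closed_loop_F_at[OF R X_M(1) posdef_det_nonzero[OF X_M(3)]] X_M(2) by simp
    then have "adj T ** mconj (Y - X_M) ** T = closed_loop A B R H ?F Y - X_M"
      using closed_loop_diff[of A B R H ?F Y X_M] by (simp add: T_def T_at_def)
    then show ?thesis
      using closed_loop_ge_ric[OF R ge_X_M[OF that], of A H ?F] by (simp add: loewner_ge_def)
  qed
  let ?Y = "(ric A B R H ^^ (2 * j)) X"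
  have Y: "?Y \<succeq> X_M"
    by (rule funpow_ric_ge_X_M[OF X])
  \<comment> \<open>The next step acts on the conjugated error, so the first bound is conjugated
    before the congruence with \<open>T\<close>; the two factors combine to
    \<open>mconj T ** T\<close>.\<close>
  have "adj T ** (adj (mconj T) ** (?Y - X_M) ** mconj T) ** T
      \<succeq> adj T ** mconj (ric A B R H ?Y - X_M) ** T"
    using congruence_mono[OF mconj_mono[OF step[OF Y]], of T] by (simp add: mconj_simps adj_mconj)
  then have "adj S ** (?Y - X_M) ** S \<succeq> ric A B R H (ric A B R H ?Y) - X_M"
    using step[OF ric_ge_X_M[OF Y]]
    by (auto intro: loewner_trans simp: S_def That_at_def T_def adj_mult matrix_mul_assoc)
  moreover have "adj (mat_pow S (Suc j)) ** (X - X_M) ** mat_pow S (Suc j)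
      \<succeq> adj S ** (?Y - X_M) ** S"
    using congruence_mono[OF Suc, of S]
    by (simp add: adj_mult matrix_mul_assoc flip: mat_pow_commute)
  ultimately show ?case
    by (auto intro: loewner_trans)
qed

text \<open>The matrix power stands on both sides of the error congruence, hence the rate
  \<open>s^2\<close> for each pair of steps.\<close>

lemma funpow_ric_error_norm:
  assumes X: "X \<succeq> X_M" and "spectral_radius (That_at A B R X_M) < s"
  shows "\<exists>C>0. \<forall>j. norm ((ric A B R H ^^ (2 * j)) X - X_M) \<le> C * (s\<^sup>2) ^ j"
proof -
  let ?S = "That_at A B R X_M"
  obtain C1 where C1: "C1 > 0" "\<And>k. norm (mat_pow ?S k) \<le> C1 * s ^ k"
    using norm_mat_pow_le[OF assms(2)] by blast
  obtain C2 where C2: "C2 > 0" "\<And>P :: complex^'n^'n. norm (adj P ** (X - X_M) ** P) \<le> C2 * (norm P)\<^sup>2"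
    using norm_congruence_le[of "X - X_M"] by blast
  let ?n = "real CARD('n)"
  have "norm ((ric A B R H ^^ (2 * j)) X - X_M) \<le> ?n ^ 3 * C2 * C1\<^sup>2 * (s\<^sup>2) ^ j" for j
  proof -
    have "norm ((ric A B R H ^^ (2 * j)) X - X_M)
        \<le> ?n ^ 3 * norm (adj (mat_pow ?S j) ** (X - X_M) ** mat_pow ?S j)"
      using funpow_ric_ge_X_M[OF X, of "2 * j"] funpow_ric_error[OF X, of j]
      by (intro loewner_norm_le) (simp_all add: loewner_ge_def)
    also have "\<dots> \<le> ?n ^ 3 * (C2 * (C1 * s ^ j)\<^sup>2)"
      using C1(2)[of j] C2(1)
      by (intro mult_left_mono order_trans[OF C2(2)] power_mono) auto
    also have "\<dots> = ?n ^ 3 * C2 * C1\<^sup>2 * (s\<^sup>2) ^ j"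
      by (simp add: power_mult_distrib power_mult[symmetric] mult.commute[of j])
    finally show ?thesis .
  qed
  moreover have "?n ^ 3 * C2 * C1\<^sup>2 > 0"
    using C1(1) C2(1) by simp
  ultimately show ?thesis
    by blast
qed

text \<open>The inner operator is \<open>ric\<close> followed by conjugation, the outer one undoes a
  conjugation before applying \<open>ric\<close>. The two cancel, leaving two steps of
  \<open>ric\<close>.\<close>

lemma realizes_hat:
  assumes "det R \<noteq> 0" "hermitian H" "det (R_at B R H) \<noteq> 0"
  shows "realizes {X. X \<succeq> X_M} (A_hat A B R H, G_hat A B R H, H_hat A B R H) (ric A B R H \<circ> ric A B R H)"
proof -
  define G where "G = G_of B R"
  have G: "hermitian G"
    using hermitian_G_of[OF R assms(1)] by (simp add: G_def)
  have det: "det (mat 1 + G ** mconj X) \<noteq> 0" if "det (R_at B R X) \<noteq> 0" for X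
    using woodbury(1)[OF assms(1) that[unfolded R_at_def]] by (simp add: G_def)
  have ric: "ric A B R H X = riccati_map (A, G, H) (mconj X)" if "X \<succeq> X_M" for X
    unfolding G_def
    by (rule ric_eq_riccati_map[OF assms(1) posdef_det_nonzero[OF ge_X_M(2)[OF that]]])
  have det_ge: "det (mat 1 + G ** mconj X) \<noteq> 0" if "X \<succeq> X_M" for X
    by (rule det[OF posdef_det_nonzero[OF ge_X_M(2)[OF that]]])
  have outer: "realizes (mconj ` {X. X \<succeq> X_M}) (A, G, H) (\<lambda>X. ric A B R H (mconj X))"
    using G assms(2) det_ge ric by (auto simp: realizes_def mconj_mconj simp del: riccati_map.simps)
  have "det (mat 1 + mconj G ** X) \<noteq> 0
      \<and> riccati_map (mconj A, mconj G, mconj H) X = mconj (ric A B R H X)" if "X \<succeq> X_M" for X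
    using det_mconj_nonzero[OF det_ge[OF that]] mconj_riccati_map[OF det_ge[OF that], of A H] ric[OF that]
    by (simp add: mconj_simps del: riccati_map.simps)
  then have inner: "realizes {X. X \<succeq> X_M} (mconj A, mconj G, mconj H) (\<lambda>X. mconj (ric A B R H X))"
    using hermitian_mconj[OF G] hermitian_mconj[OF assms(2)] by (simp add: realizes_def del: riccati_map.simps)
  have "realizes {X. X \<succeq> X_M} (afpi_step (A, G, H) (mconj A, mconj G, mconj H))
      ((\<lambda>X. ric A B R H (mconj X)) \<circ> (\<lambda>X. mconj (ric A B R H X)))"
    using ric_ge_X_M by (intro realizes_afpi_step[OF outer inner _ det[OF assms(3)]]) auto
  then show ?thesis
    using afpi_step_conjugate[OF assms(1,3), of A]
    by (simp add: G_def comp_def mconj_mconj del: afpi_step.simps)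
qed

lemma afpi_Y_eq_funpow_ric:
  assumes "det R \<noteq> 0" "hermitian H" "det (R_at B R H) \<noteq> 0" "X0 \<succeq> X_M" "1 \<le> r"
    and "afpi_no_breakdown r (A_hat A B R H, G_hat A B R H, H_hat A B R H)"
  shows "afpi_Y r (A_hat A B R H, G_hat A B R H, H_hat A B R H) X0 (Suc k)
    = (ric A B R H ^^ (2 * r ^ Suc k)) X0"
proof -
  have "(ric A B R H \<circ> ric A B R H) ` {X. X \<succeq> X_M} \<subseteq> {X. X \<succeq> X_M}"
    by (auto intro: ric_ge_X_M)
  then have "afpi_Y r (A_hat A B R H, G_hat A B R H, H_hat A B R H) X0 (Suc k)
      = ((ric A B R H \<circ> ric A B R H) ^^ (r ^ Suc k)) X0"
    using assms by (intro afpi_Y_Suc_eq_funpow[OF realizes_hat]) auto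
  moreover have "ric A B R H \<circ> ric A B R H = ric A B R H ^^ 2"
    by (simp add: numeral_2_eq_2)
  ultimately show ?thesis
    by (simp only: funpow_mult)
qed

end

section \<open>Root convergence rates\<close>

text \<open>Expand in the matrix units \<open>E i j\<close> and use the triangle inequality. The
  added 1 makes the constant visibly positive.\<close>

lemma is_matrix_norm_le:
  fixes N :: "complex^'n^'n \<Rightarrow> real"
  assumes "is_matrix_norm N"
  shows "\<exists>c>0. \<forall>M. N M \<le> c * norm M"
proof -
  define E :: "'n \<Rightarrow> 'n \<Rightarrow> complex^'n^'n" where "E i j = (\<chi> a b. if a = i \<and> b = j then 1 else 0)" for i j
  have N: "N M \<ge> 0" "N (map_matrix ((*) c) M) = cmod c * N M" "N (M + M') \<le> N M + N M'"
    "N 0 = 0" for c M M'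
    using assms by (auto simp: is_matrix_norm_def)
  have sum: "N (\<Sum>x\<in>S. f x) \<le> (\<Sum>x\<in>S. N (f x))" if "finite S" for S :: "'b set" and f
    using that by induction (auto simp: N intro: order_trans[OF N(3)])
  have M: "M = (\<Sum>(i, j)\<in>UNIV. map_matrix ((*) (M $ i $ j)) (E i j))" for M
  proof -
    have "(\<Sum>(i, j)\<in>UNIV. map_matrix ((*) (M $ i $ j)) (E i j)) $ a $ b
      = (\<Sum>x\<in>UNIV. if x = (a, b) then M $ a $ b else 0)" for a b
      unfolding sum_component by (rule sum.cong) (auto simp: E_def split: if_splits)
    then show ?thesis
      by (simp add: vec_eq_iff)
  qed
  have "N M \<le> ((\<Sum>(i, j)\<in>UNIV. N (E i j)) + 1) * norm M" for M
  proof -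
    have "N M \<le> (\<Sum>(i, j)\<in>UNIV. cmod (M $ i $ j) * N (E i j))"
      using sum[of UNIV "\<lambda>(i, j). map_matrix ((*) (M $ i $ j)) (E i j)"]
      by (simp add: case_prod_unfold N(2) M[symmetric, unfolded case_prod_unfold])
    also have "\<dots> \<le> (\<Sum>(i, j)\<in>UNIV. norm M * N (E i j))"
      unfolding case_prod_unfold
      by (intro sum_mono mult_right_mono N order_trans[OF Finite_Cartesian_Product.norm_nth_le Finite_Cartesian_Product.norm_nth_le])
    also have "\<dots> \<le> ((\<Sum>(i, j)\<in>UNIV. N (E i j)) + 1) * norm M"
      by (simp add: case_prod_unfold sum_distrib_left algebra_simps)
    finally show ?thesis .
  qed
  moreover have "(\<Sum>(i, j)\<in>UNIV. N (E i j)) + 1 > 0"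
    using N(1) by (intro add_nonneg_pos sum_nonneg) auto
  ultimately show ?thesis
    by blast
qed

lemma root_const_tendsto:
  assumes "C > 0" "filterlim g at_top F"
  shows "((\<lambda>k. root (g k) C) \<longlongrightarrow> 1) F"
  by (rule filterlim_compose[OF LIMSEQ_root_const[OF assms(1)] assms(2)])

text \<open>The constant disappears under the root of order \<open>r ^ k\<close>. The bound is
  required at successors only, matching the exceptional start of \<open>afpi_Y\<close>; the limsup
  ignores index 0.\<close>

lemma limsup_root_power_le:
  fixes f :: "nat \<Rightarrow> real"
  assumes "C > 0" "0 < q" "r > 1" and f: "\<And>k. f (Suc k) \<le> C * q ^ (r ^ Suc k)"
  shows "limsup (\<lambda>k. ereal (root (r ^ k) (f k))) \<le> ereal q"
proof -
  have pos: "r ^ k > 0" for k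
    using \<open>r > 1\<close> by simp
  have "filterlim (\<lambda>k. r ^ k) at_top sequentially"
    by (rule filterlim_subseq) (use \<open>r > 1\<close> in \<open>simp add: strict_mono_def\<close>)
  from root_const_tendsto[OF \<open>C > 0\<close> this]
  have lim: "(\<lambda>k. ereal (root (r ^ k) C * q)) \<longlonglongrightarrow> ereal (1 * q)"
    by (intro tendsto_intros)
  have "root (r ^ Suc k) (f (Suc k)) \<le> root (r ^ Suc k) C * q" for k
  proof -
    have "root (r ^ Suc k) (f (Suc k)) \<le> root (r ^ Suc k) (C * q ^ (r ^ Suc k))"
      using pos f by (rule real_root_le_mono)
    also have "\<dots> = root (r ^ Suc k) C * q"
      using pos[of "Suc k"] \<open>0 < q\<close> by (simp only: real_root_mult real_root_power_cancel less_imp_le)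
    finally show ?thesis .
  qed
  then have "\<forall>\<^sub>F k in sequentially. ereal (root (r ^ k) (f k)) \<le> ereal (root (r ^ k) C * q)"
    by (subst eventually_sequentially_Suc[symmetric]) simp
  then have "limsup (\<lambda>k. ereal (root (r ^ k) (f k))) \<le> limsup (\<lambda>k. ereal (root (r ^ k) C * q))"
    by (rule Limsup_mono)
  also have "\<dots> = ereal q"
    using lim_imp_Limsup[OF _ lim] by simp
  finally show ?thesis .
qed

text \<open>The threshold is 4 because the inequality fails at \<open>k = 3\<close>,
  \<open>r = 2\<close>.\<close>

lemma square_le_power: "4 \<le> k \<Longrightarrow> (1 < r) \<Longrightarrow> k * k \<le> (r::nat) ^ k"
proof -
  assume "4 \<le> k" "1 < r"
  have "k * k \<le> 2 ^ k"
    using \<open>4 \<le> k\<close>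
  proof (induction k rule: dec_induct)
    case (step n)
    have "2 * n + 1 \<le> n * n"
      using step.hyps mult_le_mono1[of 4 n n] by linarith
    then show ?case
      using step.IH by simp
  qed simp
  also have "\<dots> \<le> r ^ k"
    using \<open>1 < r\<close> by (intro power_mono) auto
  finally show "k * k \<le> r ^ k" .
qed

text \<open>Since \<open>k * k\<close> is eventually at most \<open>r ^ k\<close>, the
  \<open>k\<close>-th root is bounded by \<open>root k C * q ^ k\<close>, which tends to
  zero.\<close>

lemma root_tendsto_zero:
  fixes f :: "nat \<Rightarrow> real"
  assumes "C > 0" "0 < q" "q < 1" "r > 1" and f: "\<And>k. 0 \<le> f k" "\<And>k. f (Suc k) \<le> C * q ^ (r ^ Suc k)"
  shows "(\<lambda>k. root k (f k)) \<longlonglongrightarrow> 0"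
proof (rule tendsto_sandwich)
  show "\<forall>\<^sub>F k in sequentially. 0 \<le> root k (f k)"
    using f(1) by (intro always_eventually) (metis real_root_ge_zero)
  have "root k (f k) \<le> root k C * q ^ k" if "k \<ge> 4" for k
  proof -
    have "k > 0"
      using that by simp
    then have "f k \<le> C * q ^ (r ^ k)"
      using f(2)[of "k - 1"] by simp
    also have "\<dots> \<le> C * q ^ (k * k)"
      using assms that square_le_power by (intro mult_left_mono power_decreasing) auto
    finally have "root k (f k) \<le> root k (C * (q ^ k) ^ k)"
      using \<open>k > 0\<close> by (simp only: power_mult real_root_le_mono)
    also have "\<dots> = root k C * q ^ k"
      using \<open>k > 0\<close> \<open>0 < q\<close> by (simp add: real_root_mult real_root_power_cancel)
    finally show ?thesis .
  qed
  then show "\<forall>\<^sub>F k in sequentially. root k (f k) \<le> root k C * q ^ k"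
    by (rule eventually_mono[OF eventually_ge_at_top[of 4]])
  have "(\<lambda>k. root k C * q ^ k) \<longlonglongrightarrow> 1 * 0"
    using assms by (intro tendsto_mult LIMSEQ_root_const LIMSEQ_power_zero) auto
  then show "(\<lambda>k. root k C * q ^ k) \<longlonglongrightarrow> 0"
    by simp
qed simp

theorem theorem4p1:
  fixes A H X0 X_M :: "complex^'n^'n"
    and B :: "complex^'m^'n"
    and R :: "complex^'m^'m"
    and r :: nat
    and N :: "complex^'n^'n \<Rightarrow> real"
    and Y :: "nat \<Rightarrow> complex^'n^'n"
  assumes "hermitian R" and "det R \<noteq> 0" and "hermitian H"
    and "det (R + adj B ** mconj H ** B) \<noteq> 0"
    and "set_T A B R \<noteq> {}"
    and "set_R_le A B R H \<inter> set_P B R \<noteq> {}"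
    and "r > 1"
    and "X0 \<in> set_S_ge A B R H"
    and "afpi_no_breakdown r (A_hat A B R H, G_hat A B R H, H_hat A B R H)"
    and "Y = afpi_Y r (A_hat A B R H, G_hat A B R H, H_hat A B R H) X0"
    and "cdare_maximal A B R H X_M"
    and "is_matrix_norm N"
  shows "(\<forall>k. Y k \<succeq> Y (Suc k)) \<and>
    Y \<longlonglongrightarrow> X_M \<and>
    (spectral_radius (That_at A B R X_M) < 1 \<longrightarrow>
       R_superlinear N Y X_M \<and>
       limsup (\<lambda>k. ereal (root (r ^ k) (N (Y k - X_M))))
         \<le> ereal ((spectral_radius (That_at A B R X_M))\<^sup>2))"
proof -
  interpret cdare_max A H X_M B R
    by unfold_locales (fact assms)+
  let ?X = "\<lambda>k. (ric A B R H ^^ k) X0"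
  let ?rho = "spectral_radius (That_at A B R X_M)"
  note X0 = set_S_ge_imp[OF \<open>X0 \<in> set_S_ge A B R H\<close>]
  have Y: "Y (Suc k) = ?X (2 * r ^ Suc k)" for k
    unfolding \<open>Y = _\<close> using assms X0(1)
    by (intro afpi_Y_eq_funpow_ric) (auto simp: R_at_def)
  have Y0: "Y 0 = ?X 0"
    by (simp add: \<open>Y = _\<close>)
  have "Y k \<succeq> Y (Suc k)" for k
  proof (cases k)
    case 0
    then show ?thesis
      unfolding Y by (simp only: Y0 funpow_ric_decreasing[OF X0])
  next
    case (Suc j)
    have "r ^ Suc j \<le> r ^ Suc (Suc j)"
      using \<open>r > 1\<close> by (intro power_increasing) auto
    then show ?thesis
      unfolding Suc Y by (intro funpow_ric_decreasing[OF X0] mult_le_mono2)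
  qed
  moreover have lim: "Y \<longlonglongrightarrow> X_M"
  proof -
    \<comment> \<open>From index 1 on, the accelerated sequence is a subsequence of the plain
      iteration.\<close>
    have "strict_mono (\<lambda>k. 2 * r ^ Suc k)"
      using \<open>r > 1\<close> by (auto simp: strict_mono_def)
    then have "(\<lambda>k. Y (Suc k)) \<longlonglongrightarrow> X_M"
      unfolding Y using LIMSEQ_subseq_LIMSEQ[OF funpow_ric_tendsto[OF X0]] by (simp add: comp_def)
    then show ?thesis
      by (rule LIMSEQ_imp_Suc)
  qed
  moreover have "R_superlinear N Y X_M \<and>
      limsup (\<lambda>k. ereal (root (r ^ k) (N (Y k - X_M)))) \<le> ereal (?rho\<^sup>2)" if rho: "?rho < 1"
  proof -
    obtain c where c: "c > 0" "\<And>M. N M \<le> c * norm M"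
      using is_matrix_norm_le[OF \<open>is_matrix_norm N\<close>] by blast
    have bound: "\<exists>C>0. \<forall>k. N (Y (Suc k) - X_M) \<le> C * (s\<^sup>2) ^ (r ^ Suc k)" if s: "?rho < s" for s
    proof -
      obtain C where C: "C > 0" "\<And>j. norm (?X (2 * j) - X_M) \<le> C * (s\<^sup>2) ^ j"
        using funpow_ric_error_norm[OF X0(1) s] by blast
      have "N (Y (Suc k) - X_M) \<le> (c * C) * (s\<^sup>2) ^ (r ^ Suc k)" for k
        unfolding Y mult.assoc
        by (rule order_trans[OF c(2)]) (intro mult_left_mono C(2) less_imp_le[OF c(1)])
      then show ?thesis
        using c(1) C(1) by (intro exI[of _ "c * C"]) simp
    qed
    have rho0: "0 \<le> ?rho"
      by (rule spectral_radius_nonneg)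
    have "limsup (\<lambda>k. ereal (root (r ^ k) (N (Y k - X_M)))) \<le> ereal (s\<^sup>2)" if s: "?rho < s" for s
      using bound[OF s] limsup_root_power_le[OF _ _ \<open>r > 1\<close>, of _ "s\<^sup>2"] s rho0 by auto
    \<comment> \<open>The power bound needs \<open>s\<close> strictly above the spectral radius, so
      the rate follows by letting \<open>s\<close> decrease to it.\<close>
    then have ev: "\<forall>\<^sub>F s in at_right ?rho. limsup (\<lambda>k. ereal (root (r ^ k) (N (Y k - X_M)))) \<le> ereal (s\<^sup>2)"
      by (auto simp: eventually_at_filter)
    have "((\<lambda>s. ereal (s\<^sup>2)) \<longlongrightarrow> ereal (?rho\<^sup>2)) (at_right ?rho)"
      by (intro tendsto_intros)
    then have rate: "limsup (\<lambda>k. ereal (root (r ^ k) (N (Y k - X_M)))) \<le> ereal (?rho\<^sup>2)"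
      using ev by (rule tendsto_lowerbound) simp
    \<comment> \<open>For superlinearity one fixed \<open>s\<close> below 1 suffices.\<close>
    obtain s where s: "?rho < s" "s < 1"
      using rho dense by blast
    have "0 < s\<^sup>2" "s\<^sup>2 < 1"
      using s rho0 by (auto simp: power_less_one_iff)
    moreover have "0 \<le> N M" for M
      using \<open>is_matrix_norm N\<close> by (simp add: is_matrix_norm_def)
    ultimately have "(\<lambda>k. root k (N (Y k - X_M))) \<longlonglongrightarrow> 0"
      using bound[OF s(1)] root_tendsto_zero[OF _ _ _ \<open>r > 1\<close>, of _ "s\<^sup>2" "\<lambda>k. N (Y k - X_M)"] by blast
    then have "(\<lambda>k. ereal (root k (N (Y k - X_M)))) \<longlonglongrightarrow> ereal 0"
      by (rule tendsto_ereal)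
    then have "limsup (\<lambda>k. ereal (root k (N (Y k - X_M)))) = ereal 0"
      by (rule lim_imp_Limsup[rotated]) simp
    with lim rate show ?thesis
      by (simp add: R_superlinear_def zero_ereal_def)
  qed
  ultimately show ?thesis
    by blast
qed

end
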